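(* Let $n\ge 1$, $T>0$, and suppose: $\ell:\mathbb{R}^n\to\mathbb{R}$ is $C^2$, strictly convex, $\lim_{|u|\to\infty}\ell(u)/|u|=\infty$, and $\nabla^2\ell(u)$ is positive definite for every $u\in\mathbb{R}^n$; $g:\mathbb{R}^n\to\mathbb{R}$ is globally Lipschitz and differentiable; $\rho:[0,T]\to(0,1]$ is continuous. Let $d_t(s)=\exp\left(-\int_t^s\rho(r)\,dr\right)$ for $0\le t\le s\le T$, let $\iota=(\nabla\ell)^{-1}$, and let $f=\ell^*$. Then the function $$v(x,t)=\min_{p\in\mathbb{R}^n}\left\{\int_t^T d_t(s)\,\ell\big(\iota(d_t^{-1}(s)p)\big)\,ds+d_t(T)\,g\Big(x+\int_t^T\iota(d_t^{-1}(s)p)\,ds\Big)\right\}$$ is locally Lipschitz continuous in $\mathbb{R}^n\times[0,T)$ and solves the terminal value problem $$-v_t(x,t)+f(-v_x(x,t))+\rho(t)v(x,t)=0\ \text{ almost everywhere in }\mathbb{R}^n\times(0,T),\qquad v=g\ \text{ on }\mathbb{R}^n\times\{t=T\}.$$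
   Context: $\ell^*(p)=\sup_{u\in\mathbb{R}^n}\{p\cdot u-\ell(u)\}$ is the convex conjugate of $\ell$. $v_x$ is the gradient in $x$, $v_t$ the derivative in $t$. $\iota$ is the inverse function of the bijection $\nabla\ell:\mathbb{R}^n\to\mathbb{R}^n$, and $d_t^{-1}(s)=1/d_t(s)$. "Almost everywhere" means at Lebesgue-almost every point, with $v$ differentiable there. *)

theory Defs
  imports "HOL-Analysis.Analysis"
begin

definition gradient :: "('a::real_inner \<Rightarrow> real) \<Rightarrow> 'a \<Rightarrow> 'a" where
  "gradient f x = (THE D. GDERIV f x :> D)"

definition hessian :: "(real ^ 'n \<Rightarrow> real) \<Rightarrow> real ^ 'n \<Rightarrow> real ^ 'n ^ 'n::finite" where
  "hessian f x = jacobian (gradient f) (at x)"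

definition C2 :: "(real ^ 'n::finite \<Rightarrow> real) \<Rightarrow> bool" where
  "C2 f \<longleftrightarrow> (\<forall>x. f differentiable at x) \<and> (\<forall>x. gradient f differentiable at x) \<and>
     continuous_on UNIV (hessian f)"

(* Symmetry is not demanded; it is automatic for the Hessian of a C2 function. *)
definition positive_definite :: "real ^ 'n ^ 'n::finite \<Rightarrow> bool" where
  "positive_definite A \<longleftrightarrow> (\<forall>h. h \<noteq> 0 \<longrightarrow> 0 < h \<bullet> (A *v h))"

definition strictly_convex :: "('a::real_vector \<Rightarrow> real) \<Rightarrow> bool" where
  "strictly_convex f \<longleftrightarrow> (\<forall>x y u. x \<noteq> y \<longrightarrow> 0 < u \<longrightarrow> u < 1 \<longrightarrow>
     f (u *\<^sub>R x + (1 - u) *\<^sub>R y) < u * f x + (1 - u) * f y)"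

(* Real-valued: meaningful where the supremum is finite, in particular everywhere
   if f is continuous and superlinear. *)
definition convex_conjugate :: "('a::real_inner \<Rightarrow> real) \<Rightarrow> 'a \<Rightarrow> real" where
  "convex_conjugate f p = (SUP u. p \<bullet> u - f u)"

definition locally_lipschitz_on :: "'a::metric_space set \<Rightarrow> ('a \<Rightarrow> 'b::metric_space) \<Rightarrow> bool" where
  "locally_lipschitz_on S f \<longleftrightarrow> (\<forall>z\<in>S. \<exists>e>0. \<exists>L. L-lipschitz_on (ball z e \<inter> S) f)"

definition discount :: "(real \<Rightarrow> real) \<Rightarrow> real \<Rightarrow> real \<Rightarrow> real" where
  "discount \<rho> t s = exp (- integral {t..s} \<rho>)"

(* inv (gradient l) is the genuine inverse when gradient l is a bijection, as it is for
   C2, strictly convex, superlinear l. *)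
definition control :: "(real ^ 'n \<Rightarrow> real) \<Rightarrow> (real \<Rightarrow> real) \<Rightarrow> real ^ 'n \<Rightarrow> real \<Rightarrow> real \<Rightarrow> real ^ 'n::finite" where
  "control l \<rho> p t s = inv (gradient l) ((1 / discount \<rho> t s) *\<^sub>R p)"

definition cost :: "(real ^ 'n::finite \<Rightarrow> real) \<Rightarrow> (real ^ 'n \<Rightarrow> real) \<Rightarrow> (real \<Rightarrow> real) \<Rightarrow> real \<Rightarrow>
    real ^ 'n \<Rightarrow> real \<Rightarrow> real ^ 'n \<Rightarrow> real" where
  "cost l g \<rho> T x t p =
     integral {t..T} (\<lambda>s. discount \<rho> t s * l (control l \<rho> p t s)) +
     discount \<rho> t T * g (x + integral {t..T} (\<lambda>s. control l \<rho> p t s))"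

(* The infimum is a minimum only if it is attained; this is to be stated separately. *)
definition value_function :: "(real ^ 'n::finite \<Rightarrow> real) \<Rightarrow> (real ^ 'n \<Rightarrow> real) \<Rightarrow>
    (real \<Rightarrow> real) \<Rightarrow> real \<Rightarrow> real ^ 'n \<Rightarrow> real \<Rightarrow> real" where
  "value_function l g \<rho> T x t = (INF p. cost l g \<rho> T x t p)"

end

theory Submission
  imports Defs
begin

text \<open>
  Put \<open>D(s) = d\<^sub>0(s)\<close> and \<open>P = D(t) p\<close>, so that the control is \<open>u(s) = \<iota>(P / D(s))\<close>. The function
  \<open>H(P, t) = \<integral>\<^sub>t\<^sup>T D f(P / D) ds\<close> is strictly convex and superlinear in \<open>P\<close>, its gradient is the displacement
  \<open>q(P, t) = \<integral>\<^sub>t\<^sup>T u ds\<close>, and by the Fenchel equality the running cost of \<open>P\<close> is \<open>L(q(P, t), t)\<close> with the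
  conjugate \<open>L(Q, t) = max\<^sub>P (P \<bullet> Q - H(P, t))\<close>. As \<open>P \<mapsto> q(P, t)\<close> is onto, \<open>v\<close> is given by a Hopf--Lax formula,
  \<open>v(x, t) = min\<^sub>y (L(y - x, t) + D(T) g(y)) / D(t)\<close>. By strict convexity the maximiser \<open>P\<close> is unique, hence
  continuous in \<open>(Q, t)\<close>, and \<open>L\<close> is continuously differentiable with gradient \<open>(P, D f(P / D))\<close>; therefore
  each function under the minimum solves the equation. The minimum is locally over a compact set of \<open>y\<close>,
  so \<open>v\<close> is locally Lipschitz, and where \<open>v\<close> is differentiable it has the same derivative as any function
  attaining the minimum. Almost everywhere differentiability does not need Rademacher's theorem:
  it fails only where two minimisers have different gradients, and such corners form a null set.
\<close>

section \<open>Minima of coercive families of differentiable functions\<close>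

text \<open>The translates of such a set along \<open>e\<close> by distinct amounts below \<open>\<delta>\<close> are pairwise disjoint,
  so a bounded piece of positive measure would yield a bounded set of infinite measure.\<close>

lemma negligible_if_isolated_along:
  fixes S :: "'a::euclidean_space set"
  assumes S: "S \<in> sets lebesgue" and "\<delta> > 0"
    and isolated: "\<And>z \<tau>. z \<in> S \<Longrightarrow> 0 < \<tau> \<Longrightarrow> \<tau> < \<delta> \<Longrightarrow> z + \<tau> *\<^sub>R e \<notin> S"
  shows "negligible S"
proof (subst negligible_on_intervals, intro allI)
  fix a b :: 'a
  define B where "B = S \<inter> cbox a b"
  have B: "B \<in> lmeasurable"
    unfolding B_def using S by (intro bounded_set_imp_lmeasurable sets.Int bounded_Int) (auto simp: bounded_cbox)
  \<comment> \<open>Strictly decreasing with values in \<open>(0, \<delta>)\<close>, so any two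
    terms differ by an amount that \<open>isolated\<close> covers.\<close>
  define \<tau> where "\<tau> n = \<delta> / (real n + 2)" for n :: nat
  have \<tau>: "0 < \<tau> n" "\<tau> n < \<delta>" for n using \<open>\<delta> > 0\<close> by (auto simp: \<tau>_def field_simps intro: add_pos_nonneg)
  have \<tau>_less: "\<tau> n < \<tau> m" if "m < n" for m n
    using that \<open>\<delta> > 0\<close> by (auto simp: \<tau>_def intro!: divide_strict_left_mono)
  define A where "A n = (+) (\<tau> n *\<^sub>R e) ` B" for n
  have A: "A n \<in> lmeasurable" "measure lebesgue (A n) = measure lebesgue B" for n
    unfolding A_def using B by (auto simp: measure_translation intro: measurable_translation)
  have disj: "A m \<inter> A n = {}" if "m < n" for m n
  proof (rule ccontr)
    assume "A m \<inter> A n \<noteq> {}"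
    then obtain x y where xy: "x \<in> B" "y \<in> B" "\<tau> m *\<^sub>R e + x = \<tau> n *\<^sub>R e + y"
      by (auto simp: A_def)
    have "y = x + (\<tau> m - \<tau> n) *\<^sub>R e" using xy(3) by (simp add: algebra_simps)
    moreover have "x + (\<tau> m - \<tau> n) *\<^sub>R e \<notin> S"
      using isolated[of x "\<tau> m - \<tau> n"] xy(1) \<tau>_less[OF that] \<tau>[of m] \<tau>[of n] by (simp add: B_def)
    ultimately show False using xy(2) by (simp add: B_def)
  qed
  have disjoint: "disjoint_family A"
    unfolding disjoint_family_on_def using disj by (metis Int_commute linorder_neqE_nat)
  obtain K where K: "\<And>x. x \<in> cbox a b \<Longrightarrow> norm x \<le> K"
    using bounded_cbox[of a b] unfolding bounded_iff by blast
  have sub: "A n \<subseteq> cball 0 (\<delta> * norm e + K)" for n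
  proof
    fix x assume "x \<in> A n"
    then obtain y where y: "y \<in> cbox a b" "x = \<tau> n *\<^sub>R e + y" by (auto simp: A_def B_def)
    have "norm x \<le> \<tau> n * norm e + norm y"
      using norm_triangle_ineq[of "\<tau> n *\<^sub>R e" y] y(2) \<tau>[of n] by simp
    also have "\<dots> \<le> \<delta> * norm e + K"
      using K[OF y(1)] \<tau>[of n] by (intro add_mono mult_right_mono) auto
    finally show "x \<in> cball 0 (\<delta> * norm e + K)" by simp
  qed
  have bound: "real N * measure lebesgue B \<le> measure lebesgue (cball (0::'a) (\<delta> * norm e + K))" for N
  proof -
    have "real N * measure lebesgue B = (\<Sum>n<N. measure lebesgue (A n))" by (simp add: A)
    also have "\<dots> = measure lebesgue (\<Union>n<N. A n)"
      using A(1) disjoint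
      by (intro measure_finite_Union[symmetric])
        (auto simp: fmeasurableD fmeasurableD2 disjoint_family_on_def simp del: emeasure_completion)
    also have "\<dots> \<le> measure lebesgue (cball (0::'a) (\<delta> * norm e + K))"
      using sub A(1) by (intro measure_mono_fmeasurable) (auto intro!: fmeasurableD)
    finally show ?thesis .
  qed
  have "\<not> 0 < measure lebesgue B"
    using reals_Archimedean3 bound by (meson not_le)
  then show "negligible (S \<inter> cbox a b)"
    using B by (simp add: B_def negligible_iff_measure zero_less_measure_iff)
qed

text \<open>One envelope setting for three minimisations: the conjugate of \<open>l\<close>, the
  conjugate of \<open>H\<close> and the Hopf--Lax formula. The growth bound is locally uniform in
  \<open>z\<close>, so that minimisers for nearby parameters share a compact set.\<close>

locale coercive_family =
  fixes \<phi> :: "'k::euclidean_space \<Rightarrow> 'z::euclidean_space \<Rightarrow> real"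
    and G :: "'k \<Rightarrow> 'z \<Rightarrow> 'z" and U :: "'z set"
  assumes open_U: "open U"
    and has_derivative: "\<And>y z. z \<in> U \<Longrightarrow> (\<phi> y has_derivative (\<lambda>h. G y z \<bullet> h)) (at z)"
    and continuous_gradient: "continuous_on (UNIV \<times> U) (\<lambda>(y, z). G y z)"
    and continuous: "continuous_on (UNIV \<times> U) (\<lambda>(y, z). \<phi> y z)"
    and growth: "\<And>z. z \<in> U \<Longrightarrow> \<exists>e>0. \<exists>C. \<forall>w \<in> ball z e \<inter> U. \<forall>y. norm y - C \<le> \<phi> y w"
begin

section \<open>Existence and stability of minimisers\<close>

definition is_min :: "'k \<Rightarrow> 'z \<Rightarrow> bool" where
  "is_min y z \<longleftrightarrow> (\<forall>y'. \<phi> y z \<le> \<phi> y' z)"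

definition W :: "'z \<Rightarrow> real" where
  "W z = (INF y. \<phi> y z)"

lemma tendsto_family:
  assumes "(y \<longlongrightarrow> y0) F" "(z \<longlongrightarrow> z0) F" "z0 \<in> U"
  shows "((\<lambda>n. \<phi> (y n) (z n)) \<longlongrightarrow> \<phi> y0 z0) F" "((\<lambda>n. G (y n) (z n)) \<longlongrightarrow> G y0 z0) F"
proof -
  have op: "open ((UNIV :: 'k set) \<times> U)" by (simp add: open_Times open_U)
  have lim: "((\<lambda>n. (y n, z n)) \<longlongrightarrow> (y0, z0)) F" using assms by (intro tendsto_Pair)
  show "((\<lambda>n. \<phi> (y n) (z n)) \<longlongrightarrow> \<phi> y0 z0) F"
    using isCont_tendsto_compose[OF _ lim, of "\<lambda>(y, z). \<phi> y z"] continuous op assms(3)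
    by (simp add: continuous_on_eq_continuous_at)
  show "((\<lambda>n. G (y n) (z n)) \<longlongrightarrow> G y0 z0) F"
    using isCont_tendsto_compose[OF _ lim, of "\<lambda>(y, z). G y z"] continuous_gradient op assms(3)
    by (simp add: continuous_on_eq_continuous_at)
qed

text \<open>Near \<open>z\<close> the value \<open>\<phi> 0 w\<close> stays below
  \<open>\<phi> 0 z + 1\<close>, so the growth bound limits \<open>norm y\<close> uniformly in
  \<open>w\<close>. Every minimiser at \<open>w\<close> lies in such a sublevel set.\<close>

lemma sublevel_locally_bounded:
  assumes "z \<in> U"
  obtains e r where "e > 0" "cball z e \<subseteq> U"
    "\<And>w y. w \<in> cball z e \<Longrightarrow> \<phi> y w \<le> \<phi> 0 w \<Longrightarrow> norm y \<le> r"
proof -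
  obtain e1 C where e1: "e1 > 0" "\<forall>w \<in> ball z e1 \<inter> U. \<forall>y. norm y - C \<le> \<phi> y w"
    using growth[OF assms] by blast
  obtain e2 where e2: "e2 > 0" "cball z e2 \<subseteq> U"
    using open_U assms open_contains_cball by blast
  have "(\<phi> 0 \<longlongrightarrow> \<phi> 0 z) (at z)" by (rule tendsto_family) (auto simp: assms)
  then have "eventually (\<lambda>w. \<phi> 0 w < \<phi> 0 z + 1) (at z)"
    by (rule order_tendstoD) simp
  then obtain e3 where e3: "e3 > 0" "\<And>w. w \<noteq> z \<Longrightarrow> dist w z < e3 \<Longrightarrow> \<phi> 0 w < \<phi> 0 z + 1"
    unfolding eventually_at by auto
  \<comment> \<open>Halving \<open>e1\<close> and \<open>e3\<close> fits a closed ball into the open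
    ones on which the two bounds hold.\<close>
  define e where "e = min (e1 / 2) (min e2 (e3 / 2))"
  show ?thesis
  proof (rule that[of e "\<phi> 0 z + 1 + C"])
    show "e > 0" using e1 e2 e3 by (simp add: e_def)
    show sub: "cball z e \<subseteq> U" using e2(2) by (auto simp: e_def)
    fix w y assume w: "w \<in> cball z e" and le: "\<phi> y w \<le> \<phi> 0 w"
    have d: "dist z w < e1" "dist w z < e3" using w e1(1) e3(1) by (auto simp: e_def dist_commute)
    have "\<phi> 0 w < \<phi> 0 z + 1" using e3(2)[OF _ d(2)] by (cases "w = z") auto
    moreover have "norm y - C \<le> \<phi> y w" using e1(2) d w sub by auto
    ultimately show "norm y \<le> \<phi> 0 z + 1 + C" using le by simp
  qed
qed

lemma exists_min:
  assumes "z \<in> U" shows "\<exists>y. is_min y z"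
proof -
  obtain e r where er: "e > 0" "\<And>w y. w \<in> cball z e \<Longrightarrow> \<phi> y w \<le> \<phi> 0 w \<Longrightarrow> norm y \<le> r"
    using sublevel_locally_bounded[OF assms] by metis
  have "r \<ge> 0" using er(2)[of z 0] er(1) by simp
  have "continuous_on (cball 0 r) (\<lambda>y. \<phi> y z)"
    unfolding continuous_on_def by (intro ballI tendsto_family tendsto_intros assms)
  then obtain y where y: "y \<in> cball 0 r" "\<forall>y' \<in> cball 0 r. \<phi> y z \<le> \<phi> y' z"
    using continuous_attains_inf[of "cball 0 r"] \<open>r \<ge> 0\<close> by (metis compact_cball cball_eq_empty linorder_not_less)
  \<comment> \<open>A competitor at least as good as \<open>0\<close> lies in the ball; any other is
    worse than \<open>0\<close>, which is in the ball.\<close>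
  have "\<phi> y z \<le> \<phi> y' z" for y'
  proof (cases "\<phi> y' z \<le> \<phi> 0 z")
    case True then show ?thesis using er(1) er(2)[of z y'] y(2) by auto
  next
    case False
    moreover have "\<phi> y z \<le> \<phi> 0 z" using y \<open>r \<ge> 0\<close> by simp
    ultimately show ?thesis by simp
  qed
  then show ?thesis unfolding is_min_def by blast
qed

lemma W_eq: "is_min y z \<Longrightarrow> W z = \<phi> y z"
  unfolding W_def is_min_def by (intro cInf_eq_minimum) auto

lemma W_le: "z \<in> U \<Longrightarrow> W z \<le> \<phi> y z"
  using exists_min[of z] W_eq unfolding is_min_def by force

text \<open>The minimisers stay in one ball, so a subsequence converges, and the inequalities
  expressing minimality pass to the limit.\<close>

lemma argmin_limit:
  assumes "zs \<longlonglongrightarrow> z" "z \<in> U" "\<And>n. is_min (ys n) (zs n)"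
  obtains r y where "strict_mono (r :: nat \<Rightarrow> nat)" "(ys \<circ> r) \<longlonglongrightarrow> y" "is_min y z"
proof -
  obtain e K where e: "e > 0" "\<And>w y. w \<in> cball z e \<Longrightarrow> \<phi> y w \<le> \<phi> 0 w \<Longrightarrow> norm y \<le> K"
    using sublevel_locally_bounded[OF assms(2)] by metis
  obtain N where N: "\<And>n. n \<ge> N \<Longrightarrow> dist (zs n) z < e"
    using assms(1) e(1) unfolding lim_sequentially by blast
  have "ys (n + N) \<in> cball 0 K" for n
    using e(2)[of "zs (n + N)" "ys (n + N)"] N[of "n + N"] assms(3) 
    by (auto simp: is_min_def dist_commute)
  then obtain y r where r: "strict_mono r" "((\<lambda>n. ys (n + N)) \<circ> r) \<longlonglongrightarrow> y"
    using compact_cball[of 0 K] unfolding compact_def by meson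
  define r' where "r' n = r n + N" for n
  have r': "strict_mono r'" using r(1) by (auto simp: r'_def strict_mono_def)
  have ysr: "(ys \<circ> r') \<longlonglongrightarrow> y" using r(2) by (simp add: r'_def o_def)
  have zsr: "(zs \<circ> r') \<longlonglongrightarrow> z" using LIMSEQ_subseq_LIMSEQ[OF assms(1) r'] .
  have "\<phi> y z \<le> \<phi> y' z" for y'
  proof (rule LIMSEQ_le)
    show "(\<lambda>n. \<phi> ((ys \<circ> r') n) ((zs \<circ> r') n)) \<longlonglongrightarrow> \<phi> y z"
      by (rule tendsto_family[OF ysr zsr assms(2)])
    show "(\<lambda>n. \<phi> y' ((zs \<circ> r') n)) \<longlonglongrightarrow> \<phi> y' z"
      by (rule tendsto_family[OF tendsto_const zsr assms(2)])
    show "\<exists>N. \<forall>n\<ge>N. \<phi> ((ys \<circ> r') n) ((zs \<circ> r') n) \<le> \<phi> y' ((zs \<circ> r') n)"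
      using assms(3) by (simp add: is_min_def)
  qed
  then show ?thesis using that[OF r' ysr] by (simp add: is_min_def)
qed

section \<open>Regularity of the minimum function\<close>

lemma mean_value:
  assumes "closed_segment z w \<subseteq> U"
  obtains \<xi> where "\<xi> \<in> closed_segment z w" "\<phi> y w - \<phi> y z = G y \<xi> \<bullet> (w - z)"
proof -
  have seg: "z + s *\<^sub>R (w - z) \<in> closed_segment z w" if "0 \<le> s" "s \<le> 1" for s
    unfolding closed_segment_def using that by (auto intro!: exI[of _ s] simp: algebra_simps)
  have d: "((\<lambda>s. \<phi> y (z + s *\<^sub>R (w - z))) has_derivative (\<lambda>k. G y (z + s *\<^sub>R (w - z)) \<bullet> (k *\<^sub>R (w - z))))
      (at s within {0..1})" if "0 \<le> s" "s \<le> 1" for s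
  proof -
    have "((\<lambda>s. z + s *\<^sub>R (w - z)) has_derivative (\<lambda>k. k *\<^sub>R (w - z))) (at s within {0..1})"
      by (auto intro!: derivative_eq_intros)
    from has_derivative_compose[OF this has_derivative] show ?thesis
      using seg[OF that] assms by blast
  qed
  obtain s where "s \<in> {0<..<1}" "\<phi> y (z + 1 *\<^sub>R (w - z)) - \<phi> y (z + 0 *\<^sub>R (w - z)) =
      G y (z + s *\<^sub>R (w - z)) \<bullet> ((1 - 0) *\<^sub>R (w - z))"
    using mvt_simple[of 0 1 "\<lambda>s. \<phi> y (z + s *\<^sub>R (w - z))", OF _ d] by auto
  then show ?thesis using that[OF seg[of s]] by simp
qed

text \<open>A minimiser \<open>y\<close> at \<open>w\<close> gives
  \<open>W w' - W w \<le> \<phi> y w' - \<phi> y w\<close>. By the mean value theorem this is at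
  most a bound for the gradients over a compact set times the distance; exchanging \<open>w\<close>
  and \<open>w'\<close> gives the other half.\<close>

lemma W_locally_lipschitz:
  assumes "z \<in> U" shows "\<exists>e>0. \<exists>L. ball z e \<subseteq> U \<and> L-lipschitz_on (ball z e) W"
proof -
  obtain e r where er: "e > 0" "cball z e \<subseteq> U" "\<And>w y. w \<in> cball z e \<Longrightarrow> \<phi> y w \<le> \<phi> 0 w \<Longrightarrow> norm y \<le> r"
    using sublevel_locally_bounded[OF assms] by metis
  have "compact ((\<lambda>(y, z). G y z) ` (cball 0 r \<times> cball z e))"
    using er(2) by (intro compact_continuous_image continuous_on_subset[OF continuous_gradient] compact_Times) auto
  from compact_imp_bounded[OF this] obtain M where M: "\<And>y w. norm y \<le> r \<Longrightarrow> w \<in> cball z e \<Longrightarrow> norm (G y w) \<le> M"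
    unfolding bounded_iff by fastforce
  have "r \<ge> 0" using er(3)[of z 0] er(1) by simp
  then have "M \<ge> 0" using M[of 0 z] er(1) by (metis centre_in_cball less_imp_le norm_ge_zero norm_zero order_trans)
  have step: "W w' - W w \<le> M * dist w w'" if w: "w \<in> ball z e" "w' \<in> ball z e" for w w'
  proof -
    have seg: "closed_segment w w' \<subseteq> cball z e"
      using w by (intro closed_segment_subset) auto
    obtain y where y: "is_min y w" using exists_min er(2) w by (metis ball_subset_cball subsetD)
    obtain \<xi> where \<xi>: "\<xi> \<in> closed_segment w w'" "\<phi> y w' - \<phi> y w = G y \<xi> \<bullet> (w' - w)"
      using mean_value[of w w' y] seg er(2) by blast
    have "norm y \<le> r" using er(3)[of w y] w y by (simp add: is_min_def)
    then have "norm (G y \<xi>) \<le> M" using M \<xi>(1) seg by blast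
    then have "G y \<xi> \<bullet> (w' - w) \<le> M * dist w w'"
      using norm_cauchy_schwarz[of "G y \<xi>" "w' - w"]
      by (metis dist_commute dist_norm mult_right_mono norm_ge_zero order_trans)
    moreover have "w' \<in> U" using w(2) er(2) by auto
    ultimately show ?thesis using W_le[of w' y] \<xi>(2) W_eq[OF y] by linarith
  qed
  have "M-lipschitz_on (ball z e) W"
  proof (rule lipschitz_onI)
    fix w w' assume "w \<in> ball z e" "w' \<in> ball z e"
    then show "dist (W w) (W w') \<le> M * dist w w'"
      using step[of w w'] step[of w' w] by (simp add: dist_real_def dist_commute abs_if)
  qed (fact \<open>M \<ge> 0\<close>)
  then show ?thesis using er by (meson ball_subset_cball order_trans)
qed

lemma isCont_W: "z \<in> U \<Longrightarrow> isCont W z"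
proof -
  assume "z \<in> U"
  then obtain e L where "e > 0" "L-lipschitz_on (ball z e) W" using W_locally_lipschitz by blast
  then show ?thesis
    using lipschitz_on_continuous_on[of L "ball z e" W] by (simp add: continuous_on_eq_continuous_at)
qed

text \<open>The harder half of the envelope theorem. A minimiser at \<open>z + h\<close> bounds
  \<open>W (z + h) - W z\<close> below by an increment of its own function, and as \<open>h\<close>
  tends to \<open>0\<close> such minimisers accumulate at minimisers at \<open>z\<close>. Which of
  these serves may depend on \<open>h\<close>.\<close>

lemma lower_expansion:
  assumes "z \<in> U" "\<epsilon> > 0"
  shows "\<exists>\<delta>>0. \<forall>h. norm h < \<delta> \<longrightarrow> (\<exists>y. is_min y z \<and> W z + G y z \<bullet> h - \<epsilon> * norm h \<le> W (z + h))"
proof (rule ccontr)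
  assume neg: "\<not> ?thesis"
  have "\<exists>h. norm h < inverse (real (Suc n)) \<and>
    (\<forall>y. is_min y z \<longrightarrow> W (z + h) < W z + G y z \<bullet> h - \<epsilon> * norm h)" for n
    using neg by (meson inverse_positive_iff_positive not_le of_nat_0_less_iff zero_less_Suc)
  then obtain h where h: "\<And>n. norm (h n) < inverse (real (Suc n))"
    "\<And>n y. is_min y z \<Longrightarrow> W (z + h n) < W z + G y z \<bullet> h n - \<epsilon> * norm (h n)" by metis
  have h0: "h \<longlonglongrightarrow> 0"
    by (rule Lim_null_comparison[OF _ LIMSEQ_inverse_real_of_nat])
      (use h(1) in \<open>auto intro!: always_eventually less_imp_le\<close>)
  obtain e where e: "e > 0" "cball z e \<subseteq> U" using open_U assms(1) open_contains_cball by blast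
  obtain N where N: "\<And>n. n \<ge> N \<Longrightarrow> norm (h n) < e"
    using h0 e(1) unfolding lim_sequentially dist_norm by auto
  \<comment> \<open>Dropping finitely many terms keeps the segments from \<open>z\<close> to
    \<open>z + k n\<close> inside \<open>U\<close>.\<close>
  define k where "k n = h (n + N)" for n
  have k0: "k \<longlonglongrightarrow> 0" using LIMSEQ_ignore_initial_segment[OF h0, of N] by (simp add: k_def[abs_def])
  have zk: "z + k n \<in> cball z e" for n using N[of "n + N"] by (simp add: k_def dist_norm)
  have seg: "closed_segment z (z + k n) \<subseteq> cball z e" for n
    using zk[of n] e(1) by (intro closed_segment_subset) auto
  have "\<exists>y. is_min y (z + k n)" for n using exists_min zk[of n] e(2) by blast
  then obtain ys where ys: "\<And>n. is_min (ys n) (z + k n)" by metis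
  have "\<exists>\<xi>. \<xi> \<in> closed_segment z (z + k n) \<and> \<phi> (ys n) (z + k n) - \<phi> (ys n) z = G (ys n) \<xi> \<bullet> k n" for n
    using mean_value[OF order_trans[OF seg[of n] e(2)], of "ys n"] by (metis add_diff_cancel_left')
  then obtain \<xi> where \<xi>: "\<And>n. \<xi> n \<in> closed_segment z (z + k n)"
    "\<And>n. \<phi> (ys n) (z + k n) - \<phi> (ys n) z = G (ys n) (\<xi> n) \<bullet> k n" by metis
  have "norm (\<xi> n - z) \<le> norm (k n)" for n
    using segment_bound(1)[OF \<xi>(1), of n] by simp
  then have \<xi>z: "\<xi> \<longlonglongrightarrow> z"
    using Lim_null_comparison[OF _ tendsto_norm_zero[OF k0], of "\<lambda>n. \<xi> n - z"]
    by (simp add: LIM_zero_iff)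
  have "(\<lambda>n. z + k n) \<longlonglongrightarrow> z" using tendsto_add[OF tendsto_const k0, of z] by simp
  then obtain r y where r: "strict_mono (r :: nat \<Rightarrow> nat)" "(ys \<circ> r) \<longlonglongrightarrow> y" "is_min y z"
    using argmin_limit[where ys = ys and zs = "\<lambda>n. z + k n", OF _ assms(1) ys] by blast
  have "(\<lambda>n. G ((ys \<circ> r) n) ((\<xi> \<circ> r) n)) \<longlonglongrightarrow> G y z"
    by (rule tendsto_family[OF r(2) LIMSEQ_subseq_LIMSEQ[OF \<xi>z r(1)] assms(1)])
  then obtain n where n: "dist (G ((ys \<circ> r) n) ((\<xi> \<circ> r) n)) (G y z) < \<epsilon>"
    using assms(2) unfolding lim_sequentially by blast
  define m where "m = r n"
  have close: "norm (G y z - G (ys m) (\<xi> m)) < \<epsilon>" using n by (simp add: m_def dist_norm norm_minus_commute)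
  have "W (z + k m) = \<phi> (ys m) (z + k m)" using W_eq ys by blast
  moreover have "W z \<le> \<phi> (ys m) z" by (rule W_le[OF assms(1)])
  ultimately have "W z + G (ys m) (\<xi> m) \<bullet> k m \<le> W (z + k m)" using \<xi>(2)[of m] by linarith
  moreover have "(G y z - G (ys m) (\<xi> m)) \<bullet> k m \<le> \<epsilon> * norm (k m)"
    using norm_cauchy_schwarz[of "G y z - G (ys m) (\<xi> m)" "k m"] close
    by (meson less_imp_le mult_right_mono norm_ge_zero order_trans)
  moreover have "W (z + k m) < W z + G y z \<bullet> k m - \<epsilon> * norm (k m)"
    using h(2)[OF r(3)] by (simp add: k_def)
  ultimately show False by (simp add: inner_diff_left)
qed

text \<open>\<open>\<phi> y\<close> touches \<open>W\<close> from above at \<open>z\<close>, which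
  gives the upper expansion; the lower one holds for some minimiser, and all of them have the same
  gradient.\<close>

lemma W_has_derivative:
  assumes "z \<in> U" "is_min y z" "\<And>y'. is_min y' z \<Longrightarrow> G y' z = G y z"
  shows "(W has_derivative (\<lambda>h. G y z \<bullet> h)) (at z)"
  unfolding has_derivative_at_alt
proof (intro conjI allI impI)
  show "bounded_linear (\<lambda>h. G y z \<bullet> h)" by (rule bounded_linear_inner_right)
  fix \<epsilon> :: real assume "\<epsilon> > 0"
  obtain d1 where d1: "d1 > 0" "\<And>w. norm (w - z) < d1 \<Longrightarrow>
      norm (\<phi> y w - \<phi> y z - G y z \<bullet> (w - z)) \<le> \<epsilon> * norm (w - z)"
    using has_derivative[OF assms(1), of y] \<open>\<epsilon> > 0\<close> unfolding has_derivative_at_alt by blast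
  obtain d2 where d2: "d2 > 0" "\<And>h. norm h < d2 \<Longrightarrow>
      (\<exists>y. is_min y z \<and> W z + G y z \<bullet> h - \<epsilon> * norm h \<le> W (z + h))"
    using lower_expansion[OF assms(1) \<open>\<epsilon> > 0\<close>] by blast
  obtain e where e: "e > 0" "ball z e \<subseteq> U" using open_U assms(1) open_contains_ball by blast
  show "\<exists>d>0. \<forall>w. norm (w - z) < d \<longrightarrow> norm (W w - W z - G y z \<bullet> (w - z)) \<le> \<epsilon> * norm (w - z)"
  proof (intro exI[of _ "min e (min d1 d2)"] conjI allI impI)
    fix w assume w: "norm (w - z) < min e (min d1 d2)"
    then have "w \<in> U" using e(2) by (auto simp: dist_norm norm_minus_commute)
    then have "W w \<le> \<phi> y w" by (rule W_le)
    moreover obtain y' where "is_min y' z" "W z + G y' z \<bullet> (w - z) - \<epsilon> * norm (w - z) \<le> W (z + (w - z))"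
      using d2(2)[of "w - z"] w by auto
    ultimately show "norm (W w - W z - G y z \<bullet> (w - z)) \<le> \<epsilon> * norm (w - z)"
      using assms(3)[of y'] d1(2)[of w] w W_eq[OF assms(2)] by (simp add: abs_le_iff)
  qed (use e d1 d2 in auto)
qed

text \<open>\<open>\<phi> y - W\<close> is nonnegative on \<open>U\<close> and vanishes at
  \<open>z\<close>, so its derivative there is zero.\<close>

lemma W_derivative_unique:
  assumes "z \<in> U" "is_min y z" "(W has_derivative D) (at z)"
  shows "D = (\<lambda>h. G y z \<bullet> h)"
proof -
  obtain e where e: "e > 0" "ball z e \<subseteq> U" using open_U assms(1) open_contains_ball by blast
  have "((\<lambda>w. \<phi> y w - W w) has_derivative (\<lambda>h. G y z \<bullet> h - D h)) (at z)"
    by (intro has_derivative_diff has_derivative assms)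
  from differential_zero_maxmin[OF _ _ this, of "ball z e"]
  have "(\<lambda>h. G y z \<bullet> h - D h) = (\<lambda>v. 0)"
    using e W_le W_eq[OF assms(2)] by fastforce
  then show ?thesis by (auto simp: fun_eq_iff)
qed

text \<open>Otherwise minimisers along some sequence tending to \<open>z\<close> keep a distance
  from \<open>m z\<close>, although a subsequence of them tends to a minimiser at
  \<open>z\<close>.\<close>

lemma continuous_on_unique_min:
  assumes "\<And>z. z \<in> U \<Longrightarrow> is_min (m z) z" "\<And>z y. z \<in> U \<Longrightarrow> is_min y z \<Longrightarrow> y = m z"
  shows "continuous_on U m"
  unfolding continuous_on_eq_continuous_at[OF open_U]
proof
  fix z assume z: "z \<in> U"
  show "isCont m z"
  proof (rule ccontr)
    assume "\<not> isCont m z"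
    then obtain \<epsilon> where \<epsilon>: "\<epsilon> > 0" "\<And>d. d > 0 \<Longrightarrow> \<exists>w. dist w z < d \<and> dist (m w) (m z) \<ge> \<epsilon>"
      unfolding continuous_at_eps_delta by (meson not_le)
    obtain e where e: "e > 0" "ball z e \<subseteq> U" using open_U z open_contains_ball by blast
    have "\<exists>w. dist w z < min e (inverse (real (Suc n))) \<and> dist (m w) (m z) \<ge> \<epsilon>" for n
      by (rule \<epsilon>(2)) (use e in simp)
    then obtain w where w: "\<And>n. dist (w n) z < min e (inverse (real (Suc n)))" "\<And>n. dist (m (w n)) (m z) \<ge> \<epsilon>"
      by metis
    have "norm (dist (w n) z) \<le> inverse (real (Suc n))" for n using w(1)[of n] by simp
    then have "(\<lambda>n. dist (w n) z) \<longlonglongrightarrow> 0"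
      by (intro Lim_null_comparison[OF _ LIMSEQ_inverse_real_of_nat] always_eventually) blast
    then have wz: "w \<longlonglongrightarrow> z" by (rule iffD2[OF tendsto_dist_iff])
    have "w n \<in> U" for n using w(1)[of n] e(2) by (auto simp: dist_commute)
    then obtain r y where r: "(m \<circ> w \<circ> r) \<longlonglongrightarrow> y" "is_min y z"
      using argmin_limit[OF wz z, of "m \<circ> w"] assms(1) by (metis comp_apply comp_assoc)
    have "(\<lambda>n. dist ((m \<circ> w \<circ> r) n) (m z)) \<longlonglongrightarrow> 0"
      using r(1) assms(2)[OF z r(2)] by (intro iffD1[OF tendsto_dist_iff]) (simp add: o_def)
    then have "\<epsilon> \<le> 0"
      by (rule LIMSEQ_le_const) (use w(2) in auto)
    then show False using \<epsilon>(1) by simp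
  qed
qed

text \<open>Where \<open>W\<close> is not differentiable, two minimisers have gradients that differ in some coordinate
  \<open>i\<close>. In the direction \<open>i\<close>, the graph of \<open>W\<close> then has a downward corner, which separates the point from
  all nearby points with (quantitatively) the same corner.\<close>

lemma negligible_not_differentiable: "negligible {z \<in> U. \<not> W differentiable at z}"
proof -
  \<comment> \<open>Along \<open>i\<close> the graph of \<open>W\<close> lies locally under a corner
    with slope \<open>r + \<eta>\<close> to the left and \<open>r - \<eta>\<close> to the right.
    Rational \<open>r\<close> and \<open>\<eta>\<close> leave countably many such sets.\<close>
  define S where "S i r \<eta> n = {z \<in> U. \<forall>\<tau>. \<bar>\<tau>\<bar> < inverse (real (Suc n)) \<longrightarrow> z + \<tau> *\<^sub>R i \<in> U \<longrightarrow>
    W (z + \<tau> *\<^sub>R i) \<le> W z + r * \<tau> - \<eta> * \<bar>\<tau>\<bar>}" for i :: 'z and r \<eta> :: real and n :: nat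
  have neg: "negligible (S i r \<eta> n)" if "\<eta> > 0" for i r \<eta> n
  proof (rule negligible_if_isolated_along)
    show "S i r \<eta> n \<in> sets lebesgue"
    proof -
      define V where "V \<tau> = U \<inter> (\<lambda>z. z + \<tau> *\<^sub>R i) -` U" for \<tau>
      have openV: "open (V \<tau>)" for \<tau>
        unfolding V_def by (intro open_Int open_vimage open_U continuous_intros)
      have "continuous_on U W" by (simp add: continuous_at_imp_continuous_on isCont_W)
      then have "continuous_on (V \<tau>) (\<lambda>z. W (z + \<tau> *\<^sub>R i) - W z)" for \<tau>
        by (auto intro!: continuous_intros continuous_on_compose2[of U W] simp: V_def
            intro: continuous_on_subset)
      then have op: "open (V \<tau> \<inter> (\<lambda>z. W (z + \<tau> *\<^sub>R i) - W z) -` {r * \<tau> - \<eta> * \<bar>\<tau>\<bar> <..})" for \<tau>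
        by (intro continuous_open_preimage openV) auto
      \<comment> \<open>The union over \<open>\<tau>\<close> is uncountable, but its members are
        open, so \<open>S\<close> is a difference of two open sets.\<close>
      have "S i r \<eta> n = U - (\<Union>\<tau>\<in>{\<tau>. \<bar>\<tau>\<bar> < inverse (real (Suc n))}.
          V \<tau> \<inter> (\<lambda>z. W (z + \<tau> *\<^sub>R i) - W z) -` {r * \<tau> - \<eta> * \<bar>\<tau>\<bar> <..})"
        unfolding S_def V_def by (auto simp: not_le algebra_simps)
      also have "\<dots> \<in> sets lebesgue"
        using open_U op by (intro sets.Diff borel_open[THEN sets_completionI_sets[of _ lborel, simplified]] open_UN ballI)
      finally show ?thesis .
    qed
    show "inverse (real (Suc n)) > 0" by simp
    fix z \<tau> assume z: "z \<in> S i r \<eta> n" and \<tau>: "0 < \<tau>" "\<tau> < inverse (real (Suc n))"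
    show "z + \<tau> *\<^sub>R i \<notin> S i r \<eta> n"
    proof
      assume z': "z + \<tau> *\<^sub>R i \<in> S i r \<eta> n"
      \<comment> \<open>Using the corner at each of the two points to bound the value at the other,
        the sum of both bounds reads \<open>0 \<le> - 2 * \<eta> * \<tau>\<close>.\<close>
      have "W (z + \<tau> *\<^sub>R i) \<le> W z + r * \<tau> - \<eta> * \<tau>"
        using z z' \<tau> unfolding S_def by (smt (verit) mem_Collect_eq)
      moreover have "W z \<le> W (z + \<tau> *\<^sub>R i) - r * \<tau> - \<eta> * \<tau>"
      proof -
        have "z + \<tau> *\<^sub>R i + (- \<tau>) *\<^sub>R i = z" by simp
        moreover have "z \<in> U" using z by (simp add: S_def)
        moreover have "\<bar>- \<tau>\<bar> < inverse (real (Suc n))" using \<tau> by simp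
        ultimately have "W z \<le> W (z + \<tau> *\<^sub>R i) + r * (- \<tau>) - \<eta> * \<bar>- \<tau>\<bar>"
          using z' unfolding S_def mem_Collect_eq by metis
        then show ?thesis using \<tau> by simp
      qed
      moreover have "\<eta> * \<tau> > 0" using that \<tau> by simp
      ultimately show False by linarith
    qed
  qed
  have corner: "\<exists>r\<in>\<rat>. \<exists>\<eta>\<in>{0<..} \<inter> \<rat>. \<exists>n. z \<in> S i r \<eta> n"
    if z: "z \<in> U" and y: "is_min y1 z" "is_min y2 z" and less: "G y1 z \<bullet> i < G y2 z \<bullet> i" and i: "i \<in> Basis"
    for z y1 y2 i
  proof -
    obtain r where r: "r \<in> \<rat>" "G y1 z \<bullet> i < r" "r < G y2 z \<bullet> i" using Rats_dense_in_real[OF less] by blast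
    \<comment> \<open>The slopes are at most \<open>r - m\<close> and at least \<open>r + m\<close>.
      The slack \<open>m - \<eta>\<close> absorbs the first-order error, with \<open>y1\<close> used
      for \<open>\<tau> \<ge> 0\<close> and \<open>y2\<close> for \<open>\<tau> < 0\<close>.\<close>
    define m where "m = min (r - G y1 z \<bullet> i) (G y2 z \<bullet> i - r)"
    have "0 < m" using r by (simp add: m_def)
    then obtain \<eta> where \<eta>: "\<eta> \<in> \<rat>" "0 < \<eta>" "\<eta> < m" using Rats_dense_in_real by blast
    have expand: "\<exists>d>0. \<forall>w. norm (w - z) < d \<longrightarrow> norm (\<phi> y w - \<phi> y z - G y z \<bullet> (w - z)) \<le> (m - \<eta>) * norm (w - z)" for y
      using has_derivative[OF z, of y] \<eta>(3) unfolding has_derivative_at_alt by simp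
    obtain d1 where d1: "d1 > 0" "\<And>w. norm (w - z) < d1 \<Longrightarrow>
        norm (\<phi> y1 w - \<phi> y1 z - G y1 z \<bullet> (w - z)) \<le> (m - \<eta>) * norm (w - z)"
      using expand by blast
    obtain d2 where d2: "d2 > 0" "\<And>w. norm (w - z) < d2 \<Longrightarrow>
        norm (\<phi> y2 w - \<phi> y2 z - G y2 z \<bullet> (w - z)) \<le> (m - \<eta>) * norm (w - z)"
      using expand by blast
    obtain n where n: "inverse (real (Suc n)) < min d1 d2"
      using reals_Archimedean[of "min d1 d2"] d1(1) d2(1) by auto
    have "W (z + \<tau> *\<^sub>R i) \<le> W z + r * \<tau> - \<eta> * \<bar>\<tau>\<bar>"
      if \<tau>: "\<bar>\<tau>\<bar> < inverse (real (Suc n))" and U: "z + \<tau> *\<^sub>R i \<in> U" for \<tau>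
    proof -
      have nrm: "norm i = 1" using i by simp
      have close: "norm (z + \<tau> *\<^sub>R i - z) < d1" "norm (z + \<tau> *\<^sub>R i - z) < d2" using n \<tau> nrm d1(1) d2(1) by auto
      show ?thesis
      proof (cases "\<tau> \<ge> 0")
        case True
        have "W (z + \<tau> *\<^sub>R i) \<le> W z + \<tau> * (G y1 z \<bullet> i) + (m - \<eta>) * \<tau>"
          using W_le[OF U, of y1] W_eq[OF y(1)] d1(2)[OF close(1)] nrm True by (simp add: abs_le_iff)
        also have "\<dots> \<le> W z + \<tau> * (r - m) + (m - \<eta>) * \<tau>"
          using mult_left_mono[OF _ True, of "G y1 z \<bullet> i" "r - m"] by (simp add: m_def)
        finally show ?thesis using True by (simp add: algebra_simps)
      next
        case False
        have "W (z + \<tau> *\<^sub>R i) \<le> W z + \<tau> * (G y2 z \<bullet> i) - (m - \<eta>) * \<tau>"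
          using W_le[OF U, of y2] W_eq[OF y(2)] d2(2)[OF close(2)] nrm False by (simp add: abs_le_iff)
        also have "\<dots> \<le> W z + \<tau> * (r + m) - (m - \<eta>) * \<tau>"
          using mult_left_mono_neg[of "r + m" "G y2 z \<bullet> i" \<tau>] False by (simp add: m_def)
        finally show ?thesis using False by (simp add: algebra_simps)
      qed
    qed
    then have "z \<in> S i r \<eta> n" using z by (simp add: S_def)
    then show ?thesis using r(1) \<eta> by blast
  qed
  have "{z \<in> U. \<not> W differentiable at z} \<subseteq>
      (\<Union>i\<in>Basis. \<Union>r\<in>\<rat>. \<Union>\<eta>\<in>{0<..} \<inter> \<rat>. \<Union>n. S i r \<eta> n)"
  proof
    fix z assume "z \<in> {z \<in> U. \<not> W differentiable at z}"
    then have z: "z \<in> U" "\<not> W differentiable at z" by auto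
    obtain y where y: "is_min y z" using exists_min z by blast
    then obtain y' where y': "is_min y' z" "G y' z \<noteq> G y z"
      using W_has_derivative[OF z(1) y] z(2) differentiableI by blast
    obtain i where i: "i \<in> Basis" "G y' z \<bullet> i \<noteq> G y z \<bullet> i"
      using y'(2) euclidean_eqI by blast
    consider "G y' z \<bullet> i < G y z \<bullet> i" | "G y z \<bullet> i < G y' z \<bullet> i" using i by linarith
    then have "\<exists>r\<in>\<rat>. \<exists>\<eta>\<in>{0<..} \<inter> \<rat>. \<exists>n. z \<in> S i r \<eta> n"
      using corner z y y' i(1) by cases blast+
    then show "z \<in> (\<Union>i\<in>Basis. \<Union>r\<in>\<rat>. \<Union>\<eta>\<in>{0<..} \<inter> \<rat>. \<Union>n. S i r \<eta> n)"
      using i(1) by blast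
  qed
  moreover have "negligible (\<Union>i\<in>(Basis::'z set). \<Union>r\<in>\<rat>. \<Union>\<eta>\<in>{0<..} \<inter> \<rat>. \<Union>n. S i r \<eta> n)"
    by (auto intro!: negligible_countable_Union countable_image countable_rat countable_Int2 neg
        simp: countable_finite)
  ultimately show ?thesis using negligible_subset by blast
qed

end

section \<open>The conjugate of a superlinear strictly convex function\<close>

lemma gradient_eqI:
  assumes "(f has_derivative (\<lambda>h. D \<bullet> h)) (at x)"
  shows "gradient f x = D"
proof -
  have D: "GDERIV f x :> D" using assms by (simp add: gderiv_def inner_commute)
  moreover have "D' = D" if "GDERIV f x :> D'" for D'
    using has_derivative_unique[OF assms, of "\<lambda>h. D' \<bullet> h"] that
    by (simp add: gderiv_def inner_commute fun_eq_iff) (metis inner_commute vector_eq_ldot)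
  ultimately show ?thesis unfolding gradient_def by (rule the_equality)
qed

lemma has_derivative_gradient:
  fixes f :: "'a::euclidean_space \<Rightarrow> real"
  assumes "f differentiable at x"
  shows "(f has_derivative (\<lambda>h. gradient f x \<bullet> h)) (at x)"
proof -
  obtain f' where f': "(f has_derivative f') (at x)" using assms unfolding differentiable_def by blast
  have "f' = (\<lambda>h. adjoint f' 1 \<bullet> h)"
    using adjoint_works[OF has_derivative_linear[OF f'], of _ 1] by (simp add: fun_eq_iff inner_commute)
  then show ?thesis using f' gradient_eqI by metis
qed

section \<open>Fenchel duality and the inverse gradient\<close>

locale legendre =
  fixes l :: "'a::euclidean_space \<Rightarrow> real"
  assumes differentiable: "\<And>u. l differentiable at u"
    and strictly_convex: "strictly_convex l"
    and superlinear: "filterlim (\<lambda>u. l u / norm u) at_top at_infinity"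
begin

lemma continuous_l: "continuous_on S l"
  by (intro continuous_at_imp_continuous_on ballI differentiable_imp_continuous_within differentiable)

lemma superlinear_bound: "\<exists>C. \<forall>u. K * norm u - C \<le> l u"
proof -
  have "eventually (\<lambda>u. K \<le> l u / norm u) at_infinity"
    using superlinear by (simp add: filterlim_at_top)
  then obtain b where b: "\<And>u. b \<le> norm u \<Longrightarrow> K \<le> l u / norm u"
    unfolding eventually_at_infinity by blast
  \<comment> \<open>A radius of at least 1 makes \<open>norm u\<close> positive outside the ball, as
    needed to clear the quotient.\<close>
  define b' where "b' = max b 1"
  have "bounded ((\<lambda>u. K * norm u - l u) ` cball 0 b')"
    by (intro compact_imp_bounded compact_continuous_image compact_cball continuous_intros continuous_l)
  then obtain C where C: "\<And>u. norm u \<le> b' \<Longrightarrow> \<bar>K * norm u - l u\<bar> \<le> C"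
    unfolding bounded_iff real_norm_def by (metis imageI mem_cball_0)
  have "b' \<ge> 1" by (simp add: b'_def)
  then have "C \<ge> 0" using C[of 0] by simp
  have "K * norm u - C \<le> l u" for u
  proof (cases "norm u \<le> b'")
    case True then show ?thesis using C[of u] by linarith
  next
    case False
    then have "K \<le> l u / norm u" "norm u > 0" using b[of u] by (auto simp: b'_def)
    then have "K * norm u \<le> l u" by (simp add: pos_le_divide_eq)
    then show ?thesis using \<open>C \<ge> 0\<close> by simp
  qed
  then show ?thesis by blast
qed

text \<open>Conjugation of \<open>l\<close> as a minimisation over \<open>u\<close> with parameter
  \<open>p\<close>; its \<open>W\<close> is minus the conjugate.\<close>

sublocale fam: coercive_family "\<lambda>u p. l u - p \<bullet> u" "\<lambda>u p. - u" UNIV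
proof
  show "((\<lambda>p. l y - p \<bullet> y) has_derivative (\<lambda>h. - y \<bullet> h)) (at z)" for y z
    by (auto intro!: derivative_eq_intros simp: inner_commute)
  show "continuous_on (UNIV \<times> UNIV) (\<lambda>(u, p :: 'a). - u :: 'a)"
    by (auto simp: case_prod_unfold intro!: continuous_intros)
  show "continuous_on (UNIV \<times> UNIV) (\<lambda>(u, p). l u - p \<bullet> u)"
    by (auto simp: case_prod_unfold intro!: continuous_intros continuous_on_compose2[OF continuous_l])
  show "\<exists>e>0. \<exists>C. \<forall>w\<in>ball z e \<inter> UNIV. \<forall>y. norm y - C \<le> l y - w \<bullet> y" for z
  proof -
    \<comment> \<open>On the unit ball around \<open>z\<close>, \<open>w \<bullet> y\<close> uses up
      at most \<open>norm z + 1\<close> of this rate and leaves one \<open>norm y\<close>.\<close>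
    obtain C where C: "\<And>u. (norm z + 2) * norm u - C \<le> l u" using superlinear_bound by blast
    have "norm y - C \<le> l y - w \<bullet> y" if "w \<in> ball z 1" for w y
    proof -
      have "norm w \<le> norm z + 1" using that norm_triangle_ineq2[of w z] by (simp add: dist_norm norm_minus_commute)
      then have "w \<bullet> y \<le> (norm z + 1) * norm y"
        using norm_cauchy_schwarz[of w y] mult_right_mono[of "norm w" "norm z + 1" "norm y"] by simp
      then show ?thesis using C[of y] by (simp add: algebra_simps)
    qed
    then show ?thesis by (meson IntD1 zero_less_one)
  qed
qed simp

text \<open>Convexity bounds the difference quotients along the segment from \<open>u\<close> to
  \<open>w\<close> by \<open>l w - l u\<close>, and they tend to the directional derivative.\<close>

lemma tangent_below: "l u + gradient l u \<bullet> (w - u) \<le> l w"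
proof (cases "w = u")
  case False
  \<comment> \<open>The double successor keeps \<open>s n\<close> strictly below 1, as
    \<open>strictly_convex\<close> requires of its weights.\<close>
  define s where "s n = inverse (real (Suc (Suc n)))" for n
  have s: "0 < s n" "s n < 1" for n by (auto simp: s_def field_simps)
  have s0: "s \<longlonglongrightarrow> 0" unfolding s_def[abs_def] using LIMSEQ_Suc[OF LIMSEQ_inverse_real_of_nat] .
  have "((\<lambda>\<tau>. l (u + \<tau> *\<^sub>R (w - u))) has_derivative (\<lambda>k. gradient l u \<bullet> (k *\<^sub>R (w - u)))) (at 0)"
    by (rule has_derivative_compose[of "\<lambda>\<tau>. u + \<tau> *\<^sub>R (w - u)" "\<lambda>k. k *\<^sub>R (w - u)"])
      (auto intro!: derivative_eq_intros has_derivative_gradient differentiable)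
  then have "((\<lambda>\<tau>. l (u + \<tau> *\<^sub>R (w - u))) has_real_derivative (gradient l u \<bullet> (w - u))) (at 0)"
    unfolding has_field_derivative_def by (simp add: mult_commute_abs)
  then have "((\<lambda>\<tau>. (l (u + \<tau> *\<^sub>R (w - u)) - l u) / \<tau>) \<longlongrightarrow> gradient l u \<bullet> (w - u)) (at 0)"
    by (simp add: has_field_derivative_iff)
  moreover have "filterlim s (at 0) sequentially"
    using s0 less_imp_neq[OF s(1)] by (auto simp: filterlim_at)
  ultimately have "(\<lambda>n. (l (u + s n *\<^sub>R (w - u)) - l u) / s n) \<longlonglongrightarrow> gradient l u \<bullet> (w - u)"
    by (rule filterlim_compose)
  moreover have "(l (u + s n *\<^sub>R (w - u)) - l u) / s n \<le> l w - l u" for n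
  proof -
    have "s n *\<^sub>R w + (1 - s n) *\<^sub>R u = u + s n *\<^sub>R (w - u)" by (simp add: algebra_simps)
    then have "l (u + s n *\<^sub>R (w - u)) < s n * l w + (1 - s n) * l u"
      using strictly_convex False s[of n] unfolding strictly_convex_def by metis
    then show ?thesis using s(1)[of n] by (subst pos_divide_le_eq) (auto simp: algebra_simps)
  qed
  ultimately have "gradient l u \<bullet> (w - u) \<le> l w - l u" by (intro LIMSEQ_le_const2) auto
  then show ?thesis by simp
qed simp

text \<open>Fermat's rule in one direction, the tangent inequality in the other.\<close>

lemma is_min_iff: "fam.is_min u p \<longleftrightarrow> gradient l u = p"
proof
  assume min: "fam.is_min u p"
  have "((\<lambda>w. l w - p \<bullet> w) has_derivative (\<lambda>h. gradient l u \<bullet> h - p \<bullet> h)) (at u)"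
    by (intro has_derivative_diff has_derivative_gradient differentiable has_derivative_inner_right has_derivative_ident)
  from differential_zero_maxmin[OF _ _ this, of UNIV]
  have "(\<lambda>h. gradient l u \<bullet> h - p \<bullet> h) = (\<lambda>v. 0)"
    using min by (auto simp: fam.is_min_def)
  then show "gradient l u = p" by (metis eq_iff_diff_eq_0 vector_eq_rdot)
next
  assume "gradient l u = p"
  then show "fam.is_min u p"
    using tangent_below[of u] by (auto simp: fam.is_min_def inner_diff_right algebra_simps)
qed

lemma is_min_unique:
  assumes "fam.is_min u p" "fam.is_min w p" shows "u = w"
proof (rule ccontr)
  assume "u \<noteq> w"
  define m where "m = (1/2) *\<^sub>R u + (1 - 1/2) *\<^sub>R w"
  have "l m < (1/2) * l u + (1 - 1/2) * l w"
    unfolding m_def using \<open>u \<noteq> w\<close>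
    by (intro strictly_convex[unfolded strictly_convex_def, rule_format]) auto
  moreover have "p \<bullet> m = (1/2) * (p \<bullet> u) + (1/2) * (p \<bullet> w)" by (simp add: m_def inner_add_right)
  moreover have "l u - p \<bullet> u \<le> l m - p \<bullet> m" "l w - p \<bullet> w \<le> l m - p \<bullet> m"
    using assms by (auto simp: fam.is_min_def)
  ultimately show False by (simp add: field_simps)
qed

definition \<iota> :: "'a \<Rightarrow> 'a" where "\<iota> = inv (gradient l)"

text \<open>A minimiser exists for every \<open>p\<close>, so the gradient is onto and
  \<open>inv\<close> picks a true preimage.\<close>

lemma is_min_\<iota>: "fam.is_min (\<iota> p) p"
proof -
  have "surj (gradient l)" unfolding surj_def using fam.exists_min is_min_iff by (metis UNIV_I)
  then show ?thesis by (simp add: is_min_iff \<iota>_def surj_f_inv_f)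
qed

lemma continuous_\<iota>: "continuous_on UNIV \<iota>"
  using fam.continuous_on_unique_min[of \<iota>] is_min_\<iota> is_min_unique by blast

lemma convex_conjugate_eq_W: "convex_conjugate l p = - fam.W p"
proof -
  have "convex_conjugate l p = p \<bullet> \<iota> p - l (\<iota> p)"
    unfolding convex_conjugate_def using is_min_\<iota>[of p]
    by (intro cSup_eq_maximum) (auto simp: fam.is_min_def algebra_simps)
  then show ?thesis using fam.W_eq[OF is_min_\<iota>[of p]] by simp
qed

lemma convex_conjugate_eq: "convex_conjugate l p = p \<bullet> \<iota> p - l (\<iota> p)"
  using convex_conjugate_eq_W[of p] fam.W_eq[OF is_min_\<iota>[of p]] by simp

lemma fenchel_young: "p \<bullet> u - l u \<le> convex_conjugate l p"
  using convex_conjugate_eq_W[of p] fam.W_le[of p u] by simp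

lemma fenchel_equality: "p \<bullet> u - l u = convex_conjugate l p \<Longrightarrow> u = \<iota> p"
proof (rule is_min_unique[OF _ is_min_\<iota>])
  assume "p \<bullet> u - l u = convex_conjugate l p"
  then show "fam.is_min u p" using fenchel_young[of p] by (auto simp: fam.is_min_def algebra_simps)
qed

lemma gradient_\<iota>: "gradient l (\<iota> p) = p"
  using is_min_\<iota> is_min_iff by blast

lemma continuous_convex_conjugate: "continuous_on UNIV (convex_conjugate l)"
proof -
  have "convex_conjugate l = (\<lambda>p. - fam.W p)" using convex_conjugate_eq_W by auto
  moreover have "continuous_on UNIV (\<lambda>p. - fam.W p)"
    by (intro continuous_intros) (simp add: continuous_at_imp_continuous_on fam.isCont_W)
  ultimately show ?thesis by simp
qed

end

section \<open>The discounted Lagrangian\<close>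

lemma integral_rescale_unit:
  fixes h :: "real \<Rightarrow> 'b::euclidean_space"
  assumes "t \<le> T" "continuous_on {t..T} h"
  shows "integral {t..T} h = (T - t) *\<^sub>R integral {0..1} (\<lambda>r. h (t + r * (T - t)))"
proof (cases "t = T")
  case False
  with assms(1) have less: "t < T" by simp
  have "(h has_integral integral {t..T} h) (cbox t T)"
    using integrable_continuous_interval[OF assms(2)] by (simp add: integrable_integral)
  from has_integral_affinity'[OF this, of "T - t" t] less
  have "((\<lambda>r. h (t + r * (T - t))) has_integral (integral {t..T} h /\<^sub>R (T - t))) {0..1}"
    by (simp add: add.commute mult.commute)
  then show ?thesis using less by (simp add: integral_unique)
qed simp

text \<open>Rescaling to the unit interval moves \<open>t\<close> from the limit into the integrand,
  where continuity of parameter integrals over a fixed interval applies.\<close>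

lemma continuous_on_integral_moving_limit:
  fixes k :: "real \<Rightarrow> 'a::euclidean_space \<Rightarrow> 'b::euclidean_space"
  assumes "continuous_on ({a..T} \<times> UNIV) (\<lambda>(s, P). k s P)"
  shows "continuous_on (UNIV \<times> {a..T}) (\<lambda>(P, t). integral {t..T} (\<lambda>s. k s P))"
proof -
  have mid: "t + r * (T - t) \<in> {a..T}" if "t \<in> {a..T}" "r \<in> {0..1}" for t r
  proof -
    have "r * (T - t) \<le> 1 * (T - t)" "0 \<le> r * (T - t)"
      using that by (intro mult_right_mono mult_nonneg_nonneg; simp)+
    then show ?thesis using that by auto
  qed
  have "continuous_on ((UNIV \<times> {a..T}) \<times> cbox 0 1) (\<lambda>(z, r). k (snd z + r * (T - snd z)) (fst z))"
    unfolding case_prod_unfold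
    by (rule continuous_on_compose2[OF assms[unfolded case_prod_unfold],
        where f = "\<lambda>x. (snd (fst x) + snd x * (T - snd (fst x)), fst (fst x))", simplified])
      (use mid in \<open>auto intro!: continuous_intros\<close>)
  then have "continuous_on (UNIV \<times> {a..T})
      (\<lambda>z. integral {0..1} (\<lambda>r. k (snd z + r * (T - snd z)) (fst z)))"
    using integral_continuous_on_param by fastforce
  then have cont: "continuous_on (UNIV \<times> {a..T})
      (\<lambda>z. (T - snd z) *\<^sub>R integral {0..1} (\<lambda>r. k (snd z + r * (T - snd z)) (fst z)))"
    by (intro continuous_intros)
  have eq: "integral {t..T} (\<lambda>s. k s P) = (T - t) *\<^sub>R integral {0..1} (\<lambda>r. k (t + r * (T - t)) P)"
    if "t \<in> {a..T}" for P t
  proof (rule integral_rescale_unit)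
    show "continuous_on {t..T} (\<lambda>s. k s P)"
      by (rule continuous_on_compose2[OF assms[unfolded case_prod_unfold], where f = "\<lambda>s. (s, P)", simplified])
        (use that in \<open>auto intro!: continuous_intros\<close>)
  qed (use that in simp)
  show ?thesis by (rule continuous_on_eq[OF cont]) (auto simp: eq)
qed

section \<open>The discounted Hamiltonian and its time integral\<close>

locale discounted = legendre l for l :: "'a::euclidean_space \<Rightarrow> real" +
  fixes D :: "real \<Rightarrow> real" and a T :: real
  assumes a_less_T: "a < T"
    and continuous_D: "continuous_on {a..T} D"
    and D_pos: "\<And>s. s \<in> {a..T} \<Longrightarrow> 0 < D s"
begin

text \<open>For \<open>D s > 0\<close> this is the conjugate of
  \<open>\<lambda>w. D s * l w\<close>, and \<open>u s P\<close> is the point where its supremum is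
  attained.\<close>

definition k :: "real \<Rightarrow> 'a \<Rightarrow> real" where
  "k s P = D s * convex_conjugate l (P /\<^sub>R D s)"

definition u :: "real \<Rightarrow> 'a \<Rightarrow> 'a" where
  "u s P = \<iota> (P /\<^sub>R D s)"

definition H :: "'a \<Rightarrow> real \<Rightarrow> real" where
  "H P t = integral {t..T} (\<lambda>s. k s P)"

definition q :: "'a \<Rightarrow> real \<Rightarrow> 'a" where
  "q P t = integral {t..T} (\<lambda>s. u s P)"

lemma continuous_ku:
  shows "continuous_on ({a..T} \<times> UNIV) (\<lambda>(s, P). k s P)" "continuous_on ({a..T} \<times> UNIV) (\<lambda>(s, P). u s P)"
proof -
  have D: "continuous_on ({a..T} \<times> (UNIV :: 'a set)) (\<lambda>x. D (fst x))"
    by (rule continuous_on_compose2[OF continuous_D]) (auto intro!: continuous_intros)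
  then have scale: "continuous_on ({a..T} \<times> (UNIV :: 'a set)) (\<lambda>x. snd x /\<^sub>R D (fst x))"
    using D_pos by (intro continuous_intros) force+
  show "continuous_on ({a..T} \<times> UNIV) (\<lambda>(s, P). k s P)"
    unfolding k_def case_prod_unfold
    by (intro continuous_on_mult D continuous_on_compose2[OF continuous_convex_conjugate scale]) simp
  show "continuous_on ({a..T} \<times> UNIV) (\<lambda>(s, P). u s P)"
    unfolding u_def case_prod_unfold
    by (intro continuous_on_compose2[OF continuous_\<iota> scale]) simp
qed

lemma continuous_ku_time:
  assumes "t \<in> {a..T}"
  shows "continuous_on {t..T} (\<lambda>s. k s P)" "continuous_on {t..T} (\<lambda>s. u s P)"
  by (rule continuous_on_compose2[OF continuous_ku(1)[unfolded case_prod_unfold], where f = "\<lambda>s. (s, P)", simplified]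
      continuous_on_compose2[OF continuous_ku(2)[unfolded case_prod_unfold], where f = "\<lambda>s. (s, P)", simplified];
      use assms in \<open>auto intro!: continuous_intros\<close>)+

lemma continuous_H: "continuous_on (UNIV \<times> {a..T}) (\<lambda>(P, t). H P t)"
  unfolding H_def by (rule continuous_on_integral_moving_limit[OF continuous_ku(1)])

lemma continuous_q: "continuous_on (UNIV \<times> {a..T}) (\<lambda>(P, t). q P t)"
  unfolding q_def by (rule continuous_on_integral_moving_limit[OF continuous_ku(2)])

lemma D_fenchel_young: "s \<in> {a..T} \<Longrightarrow> P \<bullet> w - D s * l w \<le> k s P"
  using mult_left_mono[OF fenchel_young[of "P /\<^sub>R D s" w], of "D s"] D_pos[of s]
  by (simp add: k_def field_simps)

lemma D_fenchel_equality: "s \<in> {a..T} \<Longrightarrow> P \<bullet> w - D s * l w = k s P \<longleftrightarrow> w = u s P"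
proof
  assume s: "s \<in> {a..T}" and "P \<bullet> w - D s * l w = k s P"
  then have "(P /\<^sub>R D s) \<bullet> w - l w = convex_conjugate l (P /\<^sub>R D s)"
    using D_pos[OF s] by (simp add: k_def field_simps)
  then show "w = u s P" unfolding u_def by (rule fenchel_equality)
next
  assume s: "s \<in> {a..T}" and "w = u s P"
  then show "P \<bullet> w - D s * l w = k s P"
    using convex_conjugate_eq[of "P /\<^sub>R D s"] D_pos[OF s] by (simp add: k_def u_def field_simps)
qed

text \<open>Fenchel--Young for \<open>P'\<close>, tested with the point \<open>u s P\<close> that is
  optimal for \<open>P\<close>. Integration over \<open>s\<close> carries this over to
  \<open>H\<close> with slope \<open>q P t\<close>.\<close>

lemma k_tangent: "s \<in> {a..T} \<Longrightarrow> k s P + u s P \<bullet> (P' - P) \<le> k s P'"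
  using D_fenchel_young[of s P' "u s P"] D_fenchel_equality[of s P "u s P"]
  by (simp add: inner_diff_right inner_commute[of "u s P"])

lemma integral_u_inner: "t \<in> {a..T} \<Longrightarrow> ((\<lambda>s. u s P \<bullet> w) has_integral q P t \<bullet> w) {t..T}"
  unfolding q_def
  using has_integral_linear[OF integrable_integral[OF integrable_continuous_interval[OF continuous_ku_time(2)]]
      bounded_linear_inner_left, of t w P]
  by (simp add: o_def)

lemma integral_k: "t \<in> {a..T} \<Longrightarrow> ((\<lambda>s. k s P) has_integral H P t) {t..T}"
  unfolding H_def by (intro integrable_integral integrable_continuous_interval continuous_ku_time)

lemma H_tangent: "t \<in> {a..T} \<Longrightarrow> H P t + q P t \<bullet> (P' - P) \<le> H P' t"
  by (rule has_integral_le[OF has_integral_add[OF integral_k integral_u_inner] integral_k])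
    (auto intro: k_tangent)

text \<open>Equality makes a nonnegative continuous integrand vanish on the nondegenerate interval
  \<open>{t..T}\<close>. At time \<open>t\<close> this is equality in Fenchel--Young, hence
  \<open>u t P = u t P'\<close>, and \<open>gradient l\<close> undoes
  \<open>\<iota>\<close>.\<close>

lemma H_tangent_strict:
  assumes t: "t \<in> {a..<T}" and eq: "H P t + q P t \<bullet> (P' - P) = H P' t"
  shows "P' = P"
proof -
  let ?d = "\<lambda>s. k s P' - (k s P + u s P \<bullet> (P' - P))"
  have t': "t \<in> {a..T}" using t by simp
  have "(?d has_integral H P' t - (H P t + q P t \<bullet> (P' - P))) {t..T}"
    by (intro has_integral_diff has_integral_add integral_k integral_u_inner t')
  then have int: "(?d has_integral 0) (cbox t T)" using eq by simp
  have "continuous_on (cbox t T) ?d"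
    using continuous_ku_time[OF t'] by (auto intro!: continuous_intros)
  then have "?d t = 0"
    by (rule has_integral_0_cbox_imp_0[OF _ _ int]) (use t k_tangent in auto)
  then have "P' \<bullet> u t P - D t * l (u t P) = k t P'"
    using D_fenchel_equality[OF t', of P "u t P"]
    by (simp add: inner_diff_right inner_commute[of "u t P"])
  then have "u t P = u t P'" using D_fenchel_equality[OF t'] by blast
  then have "P /\<^sub>R D t = P' /\<^sub>R D t" unfolding u_def using gradient_\<iota> by metis
  then show ?thesis using D_pos[OF t'] by simp
qed

lemma H_has_derivative:
  assumes "t \<in> {a<..<T}"
  shows "(H P has_real_derivative - k t P) (at t)"
proof -
  have "((\<lambda>t. integral {t..T} (\<lambda>s. k s P)) has_vector_derivative - k t P) (at t within {a..T})"
    using assms a_less_T continuous_ku_time(1)[of a P] by (intro integral_has_vector_derivative') auto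
  moreover have "at t within {a..T} = at t" using assms by (simp add: at_within_Icc_at)
  ultimately show ?thesis
    unfolding H_def[abs_def] by (simp add: has_real_derivative_iff_has_vector_derivative)
qed

text \<open>Fenchel--Young is tested at all times with one vector of length \<open>r\<close> along
  \<open>P\<close>. The factor \<open>T - t\<close> stays explicit because the bound degenerates at
  \<open>T\<close>.\<close>

lemma H_superlinear:
  assumes "r \<ge> 0"
  shows "\<exists>C\<ge>0. \<forall>t\<in>{a..T}. \<forall>P. (T - t) * (r * norm P - C) \<le> H P t"
proof -
  have "compact ((\<lambda>(s, w). D s * l w) ` ({a..T} \<times> cball 0 r))"
    unfolding case_prod_unfold
    by (intro compact_continuous_image compact_Times compact_cball compact_Icc continuous_intros
      continuous_on_compose2[OF continuous_D] continuous_on_compose2[OF continuous_l[of UNIV]]) auto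
  from compact_imp_bounded[OF this]
  obtain C where C: "\<And>s w. s \<in> {a..T} \<Longrightarrow> norm w \<le> r \<Longrightarrow> \<bar>D s * l w\<bar> \<le> C"
    unfolding bounded_iff by fastforce
  have "0 \<le> C" using C[of T 0] assms a_less_T by simp
  moreover have "(T - t) * (r * norm P - C) \<le> H P t" if t: "t \<in> {a..T}" for t P
  proof -
    \<comment> \<open>For \<open>P = 0\<close> division by zero gives \<open>w = 0\<close>, and both
      properties of \<open>w\<close> still hold.\<close>
    define w where "w = (r / norm P) *\<^sub>R P"
    have w: "norm w \<le> r" "P \<bullet> w = r * norm P"
      using assms by (auto simp: w_def power2_norm_eq_inner[symmetric] power2_eq_square)
    have "((\<lambda>s. r * norm P - C) has_integral (T - t) * (r * norm P - C)) {t..T}"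
      using has_integral_const_real[of "r * norm P - C" t T] t by simp
    moreover have "r * norm P - C \<le> k s P" if "s \<in> {t..T}" for s
      using D_fenchel_young[of s P w] C[of s w] w that t by auto
    ultimately show ?thesis by (intro has_integral_le[OF _ integral_k[OF t]]) auto
  qed
  ultimately show ?thesis by blast
qed

end

section \<open>Conjugation of \<open>H\<close> jointly in displacement and time\<close>

context discounted begin

sublocale dual: coercive_family "\<lambda>P z. H P (snd z) - P \<bullet> fst z" "\<lambda>P z. (- P, - k (snd z) P)"
  "UNIV \<times> {a<..<T}"
proof
  show "((\<lambda>z. H P (snd z) - P \<bullet> fst z) has_derivative (\<bullet>) (- P, - k (snd z) P)) (at z)"
    if "z \<in> UNIV \<times> {a<..<T}" for P z
  proof -
    have "(H P has_derivative (\<lambda>h. - k (snd z) P * h)) (at (snd z))"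
      by (rule H_has_derivative[unfolded has_field_derivative_def]) (use that in auto)
    from has_derivative_compose[OF has_derivative_snd[OF has_derivative_ident] this]
    have "((\<lambda>z. H P (snd z) - P \<bullet> fst z) has_derivative (\<lambda>h. - k (snd z) P * snd h - P \<bullet> fst h)) (at z)"
      by (intro has_derivative_diff has_derivative_inner_right has_derivative_fst has_derivative_ident)
    then show ?thesis by (rule has_derivative_eq_rhs) (auto simp: inner_prod_def)
  qed
  have swap: "continuous_on (UNIV \<times> UNIV \<times> {a<..<T}) (\<lambda>x. F (snd (snd x)) (fst x))"
    if "continuous_on ({a..T} \<times> UNIV) (\<lambda>(s, P). F s P)" for F :: "real \<Rightarrow> 'a \<Rightarrow> real"
    by (rule continuous_on_compose2[OF that[unfolded case_prod_unfold],
        where f = "\<lambda>x. (snd (snd x), fst x)", simplified]) (auto intro!: continuous_intros)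
  show "continuous_on (UNIV \<times> UNIV \<times> {a<..<T}) (\<lambda>(P, z). (- P, - k (snd z) P))"
    unfolding case_prod_unfold by (intro continuous_intros swap[OF continuous_ku(1)])
  have "continuous_on (UNIV \<times> UNIV \<times> {a<..<T}) (\<lambda>x. H (fst x) (snd (snd x)))"
    by (rule continuous_on_compose2[OF continuous_H[unfolded case_prod_unfold],
        where f = "\<lambda>x. (fst x, snd (snd x))", simplified]) (auto intro!: continuous_intros)
  then show "continuous_on (UNIV \<times> UNIV \<times> {a<..<T}) (\<lambda>(P, z). H P (snd z) - P \<bullet> fst z)"
    unfolding case_prod_unfold by (intro continuous_intros)
  show "\<exists>e>0. \<exists>C. \<forall>w\<in>ball z e \<inter> UNIV \<times> {a<..<T}. \<forall>P. norm P - C \<le> H P (snd w) - P \<bullet> fst w"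
    if "z \<in> UNIV \<times> {a<..<T}" for z :: "'a \<times> real"
  proof -
    \<comment> \<open>Half the remaining time: nearby points still have
      \<open>T - snd w \<ge> \<delta>\<close>, and \<open>r\<close> is chosen so that
      \<open>\<delta> * r\<close> exceeds the bound \<open>norm (fst z) + 1\<close> for
      \<open>norm (fst w)\<close> by one.\<close>
    define \<delta> where "\<delta> = (T - snd z) / 2"
    have "\<delta> > 0" using that by (auto simp: \<delta>_def)
    define r where "r = (norm (fst z) + 2) / \<delta>"
    have "r \<ge> 0" using \<open>\<delta> > 0\<close> by (simp add: r_def)
    obtain C where C: "C \<ge> 0" "\<And>t P. t \<in> {a..T} \<Longrightarrow> (T - t) * (r * norm P - C) \<le> H P t"
      using H_superlinear[OF \<open>r \<ge> 0\<close>] by blast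
    have "norm P - (T - a) * C \<le> H P (snd w) - P \<bullet> fst w"
      if w: "w \<in> ball z (min 1 \<delta>) \<inter> UNIV \<times> {a<..<T}" for w P
    proof -
      have "dist (fst z) (fst w) < 1" "dist (snd z) (snd w) < \<delta>"
        using w dist_fst_le[of z w] dist_snd_le[of z w] by auto
      then have near: "norm (fst w) \<le> norm (fst z) + 1" "snd w < snd z + \<delta>"
        using norm_triangle_ineq2[of "fst w" "fst z"] by (auto simp: dist_norm norm_minus_commute dist_real_def)
      then have \<delta>: "\<delta> \<le> T - snd w" by (simp add: \<delta>_def field_simps)
      have "(norm (fst z) + 2) * norm P = \<delta> * (r * norm P)" using \<open>\<delta> > 0\<close> by (simp add: r_def)
      also have "\<dots> \<le> (T - snd w) * (r * norm P)" using \<delta> \<open>r \<ge> 0\<close> by (intro mult_right_mono) auto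
      finally have 1: "(norm (fst z) + 2) * norm P \<le> (T - snd w) * (r * norm P)" .
      have 2: "(T - snd w) * C \<le> (T - a) * C" using w C(1) by (intro mult_right_mono) auto
      have 3: "(T - snd w) * (r * norm P - C) \<le> H P (snd w)" using w by (intro C(2)) auto
      have "P \<bullet> fst w \<le> norm P * norm (fst w)" by (rule norm_cauchy_schwarz)
      also have "\<dots> \<le> norm P * (norm (fst z) + 1)" using near(1) by (intro mult_left_mono) auto
      finally have "P \<bullet> fst w \<le> norm P * (norm (fst z) + 1)" .
      with 1 2 3 show ?thesis by (simp add: algebra_simps)
    qed
    moreover have "min 1 \<delta> > 0" using \<open>\<delta> > 0\<close> by simp
    ultimately show ?thesis by blast
  qed
qed (simp add: open_Times)

text \<open>Minty's trick: tested against \<open>P + s v\<close> with \<open>s \<rightarrow> 0\<close>, convexity of \<open>H\<close> and continuity of \<open>q\<close>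
  give the first-order condition without differentiating \<open>H\<close> in \<open>P\<close>.\<close>

lemma dual_is_min_iff:
  assumes t: "t \<in> {a<..<T}"
  shows "dual.is_min P (Q, t) \<longleftrightarrow> q P t = Q"
proof
  assume min: "dual.is_min P (Q, t)"
  \<comment> \<open>In this direction the limiting inequality becomes
    \<open>0 \<le> - (v \<bullet> v)\<close>.\<close>
  define v where "v = Q - q P t"
  define s where "s n = inverse (real (Suc n))" for n
  have s: "s n > 0" for n by (simp add: s_def)
  have "s \<longlonglongrightarrow> 0" unfolding s_def[abs_def] by (rule LIMSEQ_inverse_real_of_nat)
  then have "(\<lambda>n. P + s n *\<^sub>R v) \<longlonglongrightarrow> P + 0 *\<^sub>R v" by (intro tendsto_intros)
  then have lim: "(\<lambda>n. P + s n *\<^sub>R v) \<longlonglongrightarrow> P" by simp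
  have "continuous_on UNIV (\<lambda>P. q P t)"
    by (rule continuous_on_compose2[OF continuous_q[unfolded case_prod_unfold], where f = "\<lambda>P. (P, t)", simplified])
      (use t in \<open>auto intro!: continuous_intros\<close>)
  then have "(\<lambda>n. q (P + s n *\<^sub>R v) t) \<longlonglongrightarrow> q P t"
    by (rule continuous_on_tendsto_compose[OF _ lim]) auto
  then have "(\<lambda>n. (q (P + s n *\<^sub>R v) t - Q) \<bullet> v) \<longlonglongrightarrow> (q P t - Q) \<bullet> v" by (intro tendsto_intros)
  moreover have "0 \<le> (q (P + s n *\<^sub>R v) t - Q) \<bullet> v" for n
  proof -
    let ?P = "P + s n *\<^sub>R v"
    have "H P t - P \<bullet> Q \<le> H ?P t - ?P \<bullet> Q" using min unfolding dual.is_min_def by simp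
    moreover have "H ?P t + q ?P t \<bullet> (P - ?P) \<le> H P t" using t by (intro H_tangent) auto
    ultimately have "0 \<le> s n * ((q ?P t - Q) \<bullet> v)"
      by (simp add: inner_diff_left inner_add_left inner_commute[of v Q] right_diff_distrib)
    then show ?thesis using s[of n] by (simp add: zero_le_mult_iff)
  qed
  ultimately have "0 \<le> (q P t - Q) \<bullet> v" by (intro LIMSEQ_le_const) auto
  also have "(q P t - Q) \<bullet> v = - (v \<bullet> v)" by (simp add: v_def inner_diff_left)
  finally have "v = 0" using inner_ge_zero[of v] inner_eq_zero_iff[of v] by linarith
  then show "q P t = Q" by (simp add: v_def)
next
  assume "q P t = Q"
  then show "dual.is_min P (Q, t)"
    using H_tangent[of t P] t by (auto simp: dual.is_min_def inner_diff_right inner_commute[of Q] algebra_simps)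
qed

text \<open>Equal minimal values mean that \<open>H\<close> meets its tangent at \<open>P\<close>
  again at \<open>P'\<close>, which strictness excludes unless \<open>P' = P\<close>.\<close>

lemma dual_is_min_unique:
  assumes t: "t \<in> {a<..<T}" and min: "dual.is_min P (Q, t)" "dual.is_min P' (Q, t)"
  shows "P' = P"
proof (rule H_tangent_strict)
  have "H P t - P \<bullet> Q = H P' t - P' \<bullet> Q"
    using min by (auto simp: dual.is_min_def intro!: antisym)
  then show "H P t + q P t \<bullet> (P' - P) = H P' t"
    using min(1) dual_is_min_iff[OF t] by (simp add: inner_diff_right inner_commute)
qed (use t in simp)

definition costate :: "'a \<times> real \<Rightarrow> 'a" where
  "costate z = (SOME P. dual.is_min P z)"

definition L :: "'a \<times> real \<Rightarrow> real" where
  "L z = - dual.W z"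

lemma is_min_costate: "z \<in> UNIV \<times> {a<..<T} \<Longrightarrow> dual.is_min (costate z) z"
  unfolding costate_def using dual.exists_min by (rule someI_ex)

lemma costate_unique: "z \<in> UNIV \<times> {a<..<T} \<Longrightarrow> dual.is_min P z \<Longrightarrow> P = costate z"
  using dual_is_min_unique[of "snd z" "costate z" "fst z" P] is_min_costate[of z] by auto

lemma continuous_costate: "continuous_on (UNIV \<times> {a<..<T}) costate"
  by (rule dual.continuous_on_unique_min[OF is_min_costate costate_unique])

lemma q_costate: "t \<in> {a<..<T} \<Longrightarrow> q (costate (Q, t)) t = Q"
  using is_min_costate[of "(Q, t)"] dual_is_min_iff by simp

text \<open>The minimiser is unique, so the envelope theorem applies at every point. The two
  components say that \<open>L\<close> solves \<open>L_t = k t L_Q\<close>.\<close>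

lemma L_has_derivative:
  assumes z: "z \<in> UNIV \<times> {a<..<T}"
  shows "(L has_derivative (\<lambda>h. (costate z, k (snd z) (costate z)) \<bullet> h)) (at z)"
proof -
  have "(dual.W has_derivative (\<lambda>h. (- costate z, - k (snd z) (costate z)) \<bullet> h)) (at z)"
    by (rule dual.W_has_derivative[OF z is_min_costate[OF z]]) (drule costate_unique[OF z], simp)
  from has_derivative_minus[OF this] show ?thesis
    by (simp add: L_def[abs_def] inner_prod_def add.commute)
qed

lemma continuous_L: "continuous_on (UNIV \<times> {a<..<T}) L"
  unfolding L_def[abs_def] by (intro continuous_intros continuous_at_imp_continuous_on ballI dual.isCont_W)

lemma L_ge: "t \<in> {a<..<T} \<Longrightarrow> P \<bullet> Q - H P t \<le> L (Q, t)"
  using dual.W_le[of "(Q, t)" P] by (simp add: L_def)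

lemma L_q: "t \<in> {a<..<T} \<Longrightarrow> L (q P t, t) = P \<bullet> q P t - H P t"
  using dual.W_eq[OF iffD2[OF dual_is_min_iff refl]] by (simp add: L_def)

text \<open>The Fenchel equality holds at each time along the control \<open>u s P\<close>;
  integrate it.\<close>

lemma integral_running_cost:
  assumes "t \<in> {a..T}"
  shows "integral {t..T} (\<lambda>s. D s * l (u s P)) = P \<bullet> q P t - H P t"
proof -
  have "((\<lambda>s. u s P \<bullet> P - k s P) has_integral q P t \<bullet> P - H P t) {t..T}"
    using assms by (intro has_integral_diff integral_u_inner integral_k)
  then have "((\<lambda>s. D s * l (u s P)) has_integral q P t \<bullet> P - H P t) {t..T}"
  proof (rule has_integral_eq[rotated])
    show "u s P \<bullet> P - k s P = D s * l (u s P)" if "s \<in> {t..T}" for s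
      using D_fenchel_equality[of s P "u s P"] assms that by (simp add: inner_commute)
  qed
  then show ?thesis by (simp add: integral_unique inner_commute)
qed

end

section \<open>The Hopf--Lax formula and the terminal value problem\<close>

locale bolza = discounted l D a T for l :: "'a::euclidean_space \<Rightarrow> real" and D a T +
  fixes g :: "'a \<Rightarrow> real" and \<rho> :: "real \<Rightarrow> real" and M :: real
  assumes lipschitz_g: "M-lipschitz_on UNIV g"
    and continuous_\<rho>: "continuous_on {a<..<T} \<rho>"
    and D_has_derivative: "\<And>t. t \<in> {a<..<T} \<Longrightarrow> (D has_real_derivative - \<rho> t * D t) (at t)"
    and D_le_1: "\<And>s. s \<in> {a..T} \<Longrightarrow> D s \<le> 1"
begin

text \<open>The cost of ending at \<open>y\<close>. Division by \<open>D t\<close> turns the weights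
  \<open>D s\<close> into discounts starting at time \<open>t\<close>.\<close>

definition \<phi> :: "'a \<Rightarrow> 'a \<times> real \<Rightarrow> real" where
  "\<phi> y z = (L (y - fst z, snd z) + D T * g y) / D (snd z)"

text \<open>The term with \<open>\<rho>\<close> comes from differentiating \<open>1 / D\<close>, as
  \<open>D' = - \<rho> * D\<close>. Since \<open>k t P = D t * f (P /\<^sub>R D t)\<close>, a
  function with this gradient solves the equation.\<close>

definition G :: "'a \<Rightarrow> 'a \<times> real \<Rightarrow> 'a \<times> real" where
  "G y z = (- (costate (y - fst z, snd z) /\<^sub>R D (snd z)),
    k (snd z) (costate (y - fst z, snd z)) / D (snd z) + \<rho> (snd z) * \<phi> y z)"

lemma \<phi>_has_derivative:
  assumes z: "z \<in> UNIV \<times> {a<..<T}"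
  shows "(\<phi> y has_derivative (\<lambda>h. G y z \<bullet> h)) (at z)"
proof -
  define P where "P = costate (y - fst z, snd z)"
  have D: "D (snd z) > 0" using z D_pos by auto
  have "((\<lambda>z. (y - fst z, snd z)) has_derivative (\<lambda>h. (- fst h, snd h))) (at z)"
    by (auto intro!: derivative_eq_intros)
  from has_derivative_compose[OF this L_has_derivative] z
  have L: "((\<lambda>z. L (y - fst z, snd z)) has_derivative (\<lambda>h. (P, k (snd z) P) \<bullet> (- fst h, snd h))) (at z)"
    by (auto simp: P_def)
  have "(D has_derivative (\<lambda>h. - \<rho> (snd z) * D (snd z) * h)) (at (snd z))"
    by (rule D_has_derivative[unfolded has_field_derivative_def]) (use z in auto)
  from has_derivative_compose[OF has_derivative_snd[OF has_derivative_ident] this]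
  have D': "((\<lambda>z. D (snd z)) has_derivative (\<lambda>h. - \<rho> (snd z) * D (snd z) * snd h)) (at z)" .
  show ?thesis
    unfolding \<phi>_def[abs_def]
    by (rule has_derivative_eq_rhs[OF has_derivative_divide'[OF has_derivative_add[OF L has_derivative_const] D']])
      (use D in \<open>auto simp: fun_eq_iff G_def \<phi>_def P_def inner_prod_def field_simps power2_eq_square\<close>)
qed

sublocale bellman: coercive_family \<phi> G "UNIV \<times> {a<..<T}"
proof
  show "(\<phi> y has_derivative (\<bullet>) (G y z)) (at z)" if "z \<in> UNIV \<times> {a<..<T}" for y z
    using \<phi>_has_derivative[OF that] .
  let ?S = "(UNIV :: 'a set) \<times> (UNIV :: 'a set) \<times> {a<..<T}"
  have shift: "continuous_on ?S (\<lambda>x. (fst x - fst (snd x), snd (snd x)))"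
    by (intro continuous_intros)
  have costate: "continuous_on ?S (\<lambda>x. costate (fst x - fst (snd x), snd (snd x)))"
    by (rule continuous_on_compose2[OF continuous_costate shift]) auto
  have L: "continuous_on ?S (\<lambda>x. L (fst x - fst (snd x), snd (snd x)))"
    by (rule continuous_on_compose2[OF continuous_L shift]) auto
  have D: "continuous_on ?S (\<lambda>x. D (snd (snd x)))"
    by (rule continuous_on_compose2[OF continuous_D]) (auto intro!: continuous_intros)
  have \<rho>: "continuous_on ?S (\<lambda>x. \<rho> (snd (snd x)))"
    by (rule continuous_on_compose2[OF continuous_\<rho>]) (auto intro!: continuous_intros)
  have D0: "D (snd (snd x)) \<noteq> 0" if "x \<in> ?S" for x
    using D_pos[of "snd (snd x)"] that by auto
  have k: "continuous_on ?S (\<lambda>x. k (snd (snd x)) (costate (fst x - fst (snd x), snd (snd x))))"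
    by (rule continuous_on_compose2[OF continuous_ku(1)[unfolded case_prod_unfold],
        where f = "\<lambda>x. (snd (snd x), costate (fst x - fst (snd x), snd (snd x)))", simplified])
      (auto intro!: continuous_intros costate)
  have g: "continuous_on ?S (\<lambda>x. g (fst x))"
    by (rule continuous_on_compose2[OF lipschitz_on_continuous_on[OF lipschitz_g]]) (auto intro!: continuous_intros)
  have \<phi>: "continuous_on ?S (\<lambda>x. \<phi> (fst x) (snd x))"
    unfolding \<phi>_def using D0 by (intro continuous_intros L g D) blast
  then show "continuous_on ?S (\<lambda>(y, z). \<phi> y z)" by (simp add: case_prod_unfold)
  show "continuous_on ?S (\<lambda>(y, z). G y z)"
    unfolding G_def case_prod_unfold using D0 by (intro continuous_intros costate k D \<rho> \<phi>) blast+
  show "\<exists>e>0. \<exists>C. \<forall>w\<in>ball z e \<inter> UNIV \<times> {a<..<T}. \<forall>y. norm y - C \<le> \<phi> y w"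
    if "z \<in> UNIV \<times> {a<..<T}" for z :: "'a \<times> real"
  proof -
    have M: "M \<ge> 0" using lipschitz_g lipschitz_on_nonneg by blast
    have DT: "D T > 0" using D_pos[of T] a_less_T by simp
    \<comment> \<open>\<open>D T * g\<close> falls at rate at most \<open>D T * M\<close>; the extra
      1 supplies the growth in \<open>norm y\<close>.\<close>
    define r where "r = D T * M + 1"
    have r: "r \<ge> 0" using M DT by (simp add: r_def)
    have "compact ((\<lambda>(P, t). H P t) ` (cball 0 r \<times> {a..T}))"
      by (intro compact_continuous_image continuous_on_subset[OF continuous_H] compact_Times) auto
    from compact_imp_bounded[OF this]
    obtain C where C: "\<And>P t. norm P \<le> r \<Longrightarrow> t \<in> {a..T} \<Longrightarrow> \<bar>H P t\<bar> \<le> C"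
      unfolding bounded_iff by fastforce
    have "C \<ge> 0" using C[of 0 T] r a_less_T by simp
    \<comment> \<open>The least value of \<open>D\<close> bounds \<open>C' / D t\<close> uniformly,
      while \<open>D t \<le> 1\<close> keeps the coefficient of \<open>norm y\<close> at least 1
      after the division.\<close>
    obtain t0 where t0: "t0 \<in> {a..T}" "\<And>t. t \<in> {a..T} \<Longrightarrow> D t0 \<le> D t"
      using continuous_attains_inf[OF compact_Icc _ continuous_D] a_less_T by auto
    define C' where "C' = r * (norm (fst z) + 1) + C + D T * \<bar>g 0\<bar>"
    have "C' \<ge> 0" using r \<open>C \<ge> 0\<close> DT by (simp add: C'_def)
    have "norm y - C' / D t0 \<le> \<phi> y w" if w: "w \<in> ball z 1 \<inter> UNIV \<times> {a<..<T}" for w y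
    proof -
      obtain x t where xt: "w = (x, t)" "t \<in> {a<..<T}" using w by (cases w) auto
      have "dist (fst z) x < 1" using w dist_fst_le[of z w] xt(1) by auto
      then have x: "norm x \<le> norm (fst z) + 1"
        using norm_triangle_ineq2[of x "fst z"] by (auto simp: dist_norm norm_minus_commute)
      define Q where "Q = y - x"
      define P where "P = (r / norm Q) *\<^sub>R Q"
      have P: "norm P \<le> r" "P \<bullet> Q = r * norm Q"
        using r by (auto simp: P_def power2_norm_eq_inner[symmetric] power2_eq_square)
      have "r * norm Q - C \<le> L (Q, t)"
        using L_ge[OF xt(2), of P Q] C[OF P(1), of t] P(2) xt(2) by auto
      moreover have "r * (norm y - (norm (fst z) + 1)) \<le> r * norm Q"
        using norm_triangle_ineq2[of y x] x r by (intro mult_left_mono) (auto simp: Q_def)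
      moreover have "D T * g y \<ge> - (D T * \<bar>g 0\<bar>) - D T * (M * norm y)"
      proof -
        have "\<bar>g y - g 0\<bar> \<le> M * norm y"
          using lipschitz_onD[OF lipschitz_g, of y 0] by (simp add: dist_real_def)
        then have "- \<bar>g 0\<bar> - M * norm y \<le> g y" by linarith
        from mult_left_mono[OF this, of "D T"] show ?thesis using DT by (simp add: algebra_simps)
      qed
      ultimately have "norm y \<le> L (Q, t) + D T * g y + C'"
        by (simp add: C'_def r_def algebra_simps)
      moreover have Dt: "0 < D t" "D t \<le> 1" "D t0 \<le> D t" "0 < D t0"
        using D_pos D_le_1 t0 xt(2) by auto
      ultimately have "norm y * D t \<le> L (Q, t) + D T * g y + C'"
        using mult_left_mono[of "D t" 1 "norm y"] by simp
      then have "norm y \<le> (L (Q, t) + D T * g y + C') / D t"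
        using Dt(1) by (simp add: pos_le_divide_eq)
      moreover have "C' / D t \<le> C' / D t0" using Dt \<open>C' \<ge> 0\<close> by (intro divide_left_mono) auto
      ultimately show ?thesis by (simp add: \<phi>_def xt(1) Q_def add_divide_distrib)
    qed
    moreover have "(1 :: real) > 0" by simp
    ultimately show ?thesis by blast
  qed
qed (simp add: open_Times)

end

section \<open>From endpoints back to costates, and the equation for the minimum\<close>

context bolza begin

text \<open>Every endpoint \<open>y\<close> is reached, by the costate belonging to the displacement
  \<open>y - x\<close>; so minimising over \<open>p\<close> and over \<open>y\<close> is the
  same.\<close>

lemma range_displacement:
  assumes "t \<in> {a<..<T}"
  shows "range (\<lambda>p. \<phi> (x + q (D t *\<^sub>R p) t) (x, t)) = range (\<lambda>y. \<phi> y (x, t))"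
proof -
  have "D t > 0" using assms D_pos by auto
  then have "y = x + q (D t *\<^sub>R (costate (y - x, t) /\<^sub>R D t)) t" for y
    using q_costate[OF assms, of "y - x"] by simp
  then have "range (\<lambda>p. x + q (D t *\<^sub>R p) t) = UNIV" by blast
  then show ?thesis using image_image[of "\<lambda>y. \<phi> y (x, t)" "\<lambda>p. x + q (D t *\<^sub>R p) t" UNIV] by simp
qed

lemma bellman_eq_INF:
  assumes "t \<in> {a<..<T}"
  shows "(INF p. \<phi> (x + q (D t *\<^sub>R p) t) (x, t)) = bellman.W (x, t)"
  unfolding bellman.W_def range_displacement[OF assms] ..

lemma bellman_attained:
  assumes "t \<in> {a<..<T}"
  shows "\<exists>p. bellman.W (x, t) = \<phi> (x + q (D t *\<^sub>R p) t) (x, t)"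
proof -
  obtain y where "bellman.is_min y (x, t)" using bellman.exists_min[of "(x, t)"] assms by auto
  then have "bellman.W (x, t) \<in> range (\<lambda>y. \<phi> y (x, t))" using bellman.W_eq by blast
  then show ?thesis unfolding range_displacement[OF assms, symmetric] by blast
qed

lemma \<phi>_displacement:
  assumes "t \<in> {a<..<T}"
  shows "\<phi> (x + q P t) (x, t) =
    (integral {t..T} (\<lambda>s. D s * l (u s P)) + D T * g (x + q P t)) / D t"
  using L_q[OF assms, of P] integral_running_cost[of t P] assms by (simp add: \<phi>_def)

text \<open>A derivative of the minimum must be that of \<open>\<phi> y\<close> for a minimiser
  \<open>y\<close>, and \<open>G\<close> satisfies the equation identically.\<close>

lemma bellman_equation:
  assumes z: "t \<in> {a<..<T}" and diff: "bellman.W differentiable at (x, t)"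
  shows "\<exists>c. ((\<lambda>s. bellman.W (x, s)) has_real_derivative c) (at t) \<and>
    - c + convex_conjugate l (- gradient (\<lambda>y. bellman.W (y, t)) x) + \<rho> t * bellman.W (x, t) = 0"
proof -
  have z': "(x, t) \<in> UNIV \<times> {a<..<T}" using z by simp
  obtain y where y: "bellman.is_min y (x, t)" using bellman.exists_min[OF z'] by blast
  have W: "(bellman.W has_derivative (\<lambda>h. G y (x, t) \<bullet> h)) (at (x, t))"
    using diff bellman.W_derivative_unique[OF z' y] unfolding differentiable_def by metis
  have "((\<lambda>s. (x, s)) has_derivative (\<lambda>h. (0, h))) (at t)"
    by (auto intro!: derivative_eq_intros)
  from has_derivative_compose[OF this W]
  have time: "((\<lambda>s. bellman.W (x, s)) has_real_derivative snd (G y (x, t))) (at t)"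
    unfolding has_field_derivative_def by (simp add: inner_prod_def)
  have "((\<lambda>y. (y, t)) has_derivative (\<lambda>h. (h, 0))) (at x)"
    by (auto intro!: derivative_eq_intros)
  from has_derivative_compose[OF this W]
  have space: "gradient (\<lambda>y. bellman.W (y, t)) x = fst (G y (x, t))"
    by (intro gradient_eqI) (simp add: inner_prod_def)
  have "D t > 0" using z D_pos by auto
  then show ?thesis
    using time space bellman.W_eq[OF y]
    by (intro exI[of _ "snd (G y (x, t))"]) (simp add: G_def k_def)
qed

end

section \<open>Transfer to the original data\<close>

theorem corollary5p1:
  fixes l g :: "real ^ 'n::finite \<Rightarrow> real" and \<rho> :: "real \<Rightarrow> real" and T :: real
  assumes "T > 0"
    and "C2 l"
    and "strictly_convex l"
    and "filterlim (\<lambda>u. l u / norm u) at_top at_infinity"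
    and "\<And>u. positive_definite (hessian l u)"
    and "\<exists>L. L-lipschitz_on UNIV g"
    and "\<And>x. g differentiable at x"
    and "continuous_on {0..T} \<rho>"
    and "\<rho> ` {0..T} \<subseteq> {0<..1}"
  shows "let v = value_function l g \<rho> T; f = convex_conjugate l in
     (\<forall>x. \<forall>t\<in>{0..T}. \<exists>p. v x t = cost l g \<rho> T x t p \<and> (\<forall>q. v x t \<le> cost l g \<rho> T x t q)) \<and>
     locally_lipschitz_on (UNIV \<times> {0..<T}) (\<lambda>(x, t). v x t) \<and>
     (AE (x, t) in lebesgue_on (UNIV \<times> {0<..<T}).
        (\<lambda>(y, s). v y s) differentiable at (x, t) \<and>
        - deriv (\<lambda>s. v x s) t + f (- gradient (\<lambda>y. v y t) x) + \<rho> t * v x t = 0) \<and>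
     (\<forall>x. v x T = g x)"
proof -
  obtain M where M: "M-lipschitz_on UNIV g" using assms(6) by blast
  txt \<open>Extending \<open>\<rho>\<close> to negative times makes \<open>t = 0\<close> an interior time.\<close>
  define \<rho>' where "\<rho>' s = \<rho> (max 0 (min T s))" for s
  have \<rho>': "continuous_on S \<rho>'" for S
    unfolding \<rho>'_def using assms(1)
    by (intro continuous_on_compose2[OF assms(8)] continuous_intros) auto
  have \<rho>'_eq: "\<rho>' s = \<rho> s" if "s \<in> {0..T}" for s using that by (simp add: \<rho>'_def)
  have "max 0 (min T s) \<in> {0..T}" for s using assms(1) by auto
  then have \<rho>'_nonneg: "\<rho>' s \<ge> 0" for s
    unfolding \<rho>'_def using assms(9) by (meson greaterThanAtMost_iff image_subset_iff less_imp_le)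
  \<comment> \<open>Discounts enter only as ratios \<open>D s / D t\<close>, so the base time
    \<open>-1\<close> cancels.\<close>
  define D where "D s = exp (- integral {-1..s} \<rho>')" for s
  interpret b: bolza l D "-1" T g \<rho>' M
  proof
    show "l differentiable at u" for u using assms(2) by (simp add: C2_def)
    have "continuous_on {-1..T} (\<lambda>s. integral {-1..s} \<rho>')"
      by (intro indefinite_integral_continuous_1 integrable_continuous_interval \<rho>')
    then show "continuous_on {-1..T} D" unfolding D_def[abs_def] by (intro continuous_intros)
    show "(D has_real_derivative - \<rho>' t * D t) (at t)" if "t \<in> {-1<..<T}" for t
    proof -
      have "((\<lambda>s. integral {-1..s} \<rho>') has_real_derivative \<rho>' t) (at t within {-1..T})"
        using that by (intro integral_has_real_derivative \<rho>') auto
      moreover have "at t within {-1..T} = at t" using that by (simp add: at_within_Icc_at)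
      ultimately show ?thesis unfolding D_def[abs_def]
        by (auto intro!: derivative_eq_intros)
    qed
    show "D s \<le> 1" for s
      unfolding D_def using \<rho>'_nonneg by (simp add: integral_nonneg integrable_continuous_interval \<rho>')
  qed (use assms(1,3,4) M in \<open>auto simp: D_def intro: \<rho>'\<close>)
  have D_pos: "D s > 0" for s by (simp add: D_def)
  have discount: "discount \<rho> t s = D s / D t" if "0 \<le> t" "t \<le> s" "s \<le> T" for t s
  proof -
    have "integral {t..s} \<rho> = integral {t..s} \<rho>'"
      using that by (intro integral_cong) (simp add: \<rho>'_eq)
    moreover have "integral {-1..t} \<rho>' + integral {t..s} \<rho>' = integral {-1..s} \<rho>'"
      using that by (intro Henstock_Kurzweil_Integration.integral_combine integrable_continuous_interval \<rho>') auto
    ultimately show ?thesis by (simp add: discount_def D_def exp_diff[symmetric] algebra_simps)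
  qed
  \<comment> \<open>As \<open>1 / discount \<rho> t s = D t / D s\<close>, the control for
    \<open>p\<close> is that of the costate \<open>D t *\<^sub>R p\<close>.\<close>
  have cost: "cost l g \<rho> T x t p = b.\<phi> (x + b.q (D t *\<^sub>R p) t) (x, t)" if t: "t \<in> {0..<T}" for x t p
  proof -
    have control: "control l \<rho> p t s = b.u s (D t *\<^sub>R p)" if "s \<in> {t..T}" for s
      using discount[of t s] that t by (simp add: control_def b.u_def b.\<iota>_def divide_inverse mult.commute)
    have "integral {t..T} (control l \<rho> p t) = b.q (D t *\<^sub>R p) t"
      unfolding b.q_def by (intro integral_cong control)
    moreover have "integral {t..T} (\<lambda>s. discount \<rho> t s * l (control l \<rho> p t s)) =
        integral {t..T} (\<lambda>s. D s * l (b.u s (D t *\<^sub>R p)) / D t)"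
      using discount t by (intro integral_cong) (simp add: control)
    ultimately show ?thesis
      using b.\<phi>_displacement[of t x "D t *\<^sub>R p"] discount[of t T] t
      by (simp add: cost_def add_divide_distrib)
  qed
  define v where "v = value_function l g \<rho> T"
  have v: "v x t = b.bellman.W (x, t)" if "t \<in> {0..<T}" for x t
    using b.bellman_eq_INF[of t x] that by (simp add: v_def value_function_def cost)
  \<comment> \<open>At \<open>t = T\<close> the integrals run over a single point and the discount
    is \<open>exp 0\<close>, so the cost is the same for all \<open>p\<close>.\<close>
  have terminal: "cost l g \<rho> T x T p = g x" for x p by (simp add: cost_def discount_def)
  have v_T: "v x T = g x" for x by (simp add: v_def value_function_def terminal)
  have "\<exists>p. v x t = cost l g \<rho> T x t p \<and> (\<forall>q. v x t \<le> cost l g \<rho> T x t q)" if "t \<in> {0..T}" for x t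
  proof (cases "t = T")
    case False
    then have t: "t \<in> {0..<T}" using that by simp
    then show ?thesis
      using b.bellman_attained[of t x] b.bellman.W_le[of "(x, t)"] by (simp add: v cost)
  qed (simp add: v_T terminal)
  moreover have "locally_lipschitz_on (UNIV \<times> {0..<T}) (\<lambda>(x, t). v x t)"
    unfolding locally_lipschitz_on_def
  proof
    fix z :: "(real ^ 'n) \<times> real" assume z: "z \<in> UNIV \<times> {0..<T}"
    then obtain e L where e: "e > 0" "L-lipschitz_on (ball z e) b.bellman.W"
      using b.bellman.W_locally_lipschitz[of z] by force
    have "L-lipschitz_on (ball z e \<inter> UNIV \<times> {0..<T}) b.bellman.W"
      by (rule lipschitz_on_subset[OF e(2)]) blast
    then have "L-lipschitz_on (ball z e \<inter> UNIV \<times> {0..<T}) (\<lambda>(x, t). v x t)"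
      by (rule lipschitz_on_transform) (auto simp: v)
    then show "\<exists>e>0. \<exists>L. L-lipschitz_on (ball z e \<inter> UNIV \<times> {0..<T}) (\<lambda>(x, t). v x t)"
      using e(1) by blast
  qed
  moreover have "AE (x, t) in lebesgue_on (UNIV \<times> {0<..<T}).
        (\<lambda>(y, s). v y s) differentiable at (x, t) \<and>
        - deriv (\<lambda>s. v x s) t + convex_conjugate l (- gradient (\<lambda>y. v y t) x) + \<rho> t * v x t = 0"
  proof -
    let ?N = "{z \<in> UNIV \<times> {-1<..<T}. \<not> b.bellman.W differentiable at z}"
    have op: "open ((UNIV :: (real ^ 'n) set) \<times> {0<..<T})" by (simp add: open_Times)
    have good: "(\<lambda>(y, s). v y s) differentiable at (x, t) \<and>
        - deriv (\<lambda>s. v x s) t + convex_conjugate l (- gradient (\<lambda>y. v y t) x) + \<rho> t * v x t = 0"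
      if t: "t \<in> {0<..<T}" and diff: "b.bellman.W differentiable at (x, t)" for x t
    proof
      obtain W' where "(b.bellman.W has_derivative W') (at (x, t))" using diff differentiable_def by blast
      then have "((\<lambda>(y, s). v y s) has_derivative W') (at (x, t))"
        by (rule has_derivative_transform_within_open[OF _ op]) (use t in \<open>auto simp: v\<close>)
      then show "(\<lambda>(y, s). v y s) differentiable at (x, t)" by (rule differentiableI)
      obtain c where c: "((\<lambda>s. b.bellman.W (x, s)) has_real_derivative c) (at t)"
        "- c + convex_conjugate l (- gradient (\<lambda>y. b.bellman.W (y, t)) x) + \<rho>' t * b.bellman.W (x, t) = 0"
        using b.bellman_equation[of t x] t diff by auto
      have "((\<lambda>s. v x s) has_real_derivative c) (at t)"
        by (rule has_field_derivative_transform_within_open[OF c(1), of "{0<..<T}"]) (use t in \<open>auto simp: v\<close>)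
      then have "deriv (\<lambda>s. v x s) t = c" by (rule DERIV_imp_deriv)
      then show "- deriv (\<lambda>s. v x s) t + convex_conjugate l (- gradient (\<lambda>y. v y t) x) + \<rho> t * v x t = 0"
        using c(2) t by (simp add: v \<rho>'_eq)
    qed
    \<comment> \<open>The exceptional set lies in the strip that starts at time \<open>-1\<close>;
      restricting to positive times keeps it null.\<close>
    have "AE z in lebesgue. z \<notin> ?N"
      using b.bellman.negligible_not_differentiable
      by (intro AE_not_in) (simp add: negligible_iff_null_sets)
    then have "AE z in lebesgue. z \<in> UNIV \<times> {0<..<T} \<longrightarrow> (case z of (x, t) \<Rightarrow>
        (\<lambda>(y, s). v y s) differentiable at (x, t) \<and>
        - deriv (\<lambda>s. v x s) t + convex_conjugate l (- gradient (\<lambda>y. v y t) x) + \<rho> t * v x t = 0)"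
      by (rule AE_mp) (intro AE_I2, use good in auto)
    then show ?thesis
      using op by (subst AE_restrict_space_iff) auto
  qed
  ultimately show ?thesis using v_T unfolding Let_def v_def by blast
qed

end
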